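(* Let $A$ be a commutative ring, let $K$ be an $A$-algebra, and let $U\subseteq K$ be a multiplicatively closed set. For every positive integer $n$ define the multiplicatively closed set $U(n)=\{f\otimes\cdots\otimes f\mid f\in U\}\subseteq\otimes_A^{(n)}K$. Then there is a canonical isomorphism $$\otimes_A^{(n)}K_U\cong\big(\otimes_A^{(n)}K\big)_{U(n)}.$$ In particular, for $U\subseteq A[X]$ a multiplicatively closed subset, $(\otimes_A^{(n)}A[X])_{U(n)}\cong\otimes_A^{(n)}A[X]_U$.
   Context: Rings and algebras are commutative with unit, and $K_U$ is the fraction ring of $K$ with respect to $U$. For an $A$-algebra $K$, the symmetric group $\mathfrak{S}_n$ acts on the $n$-fold tensor product $\otimes_A^nK=K\otimes_A\cdots\otimes_AK$ by permuting the tensor factors, and $\otimes_A^{(n)}K$ denotes the subring of invariant (symmetric) tensors. *)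

theory Defs
  imports
    "HOL-Algebra.Module"
    "HOL-Algebra.QuotRing"
    "HOL-Algebra.UnivPoly"
    "HOL-Algebra.Product_Groups"
    "HOL-Combinatorics.Permutations"
begin

definition alg_iso ::
  "('a, 'm) ring_scheme \<Rightarrow> ('a, 'b, 'k) module_scheme \<Rightarrow> ('a, 'c, 'l) module_scheme \<Rightarrow> ('b \<Rightarrow> 'c) set"
  where "alg_iso A M N =
    {h \<in> ring_iso M N. \<forall>a\<in>carrier A. \<forall>x\<in>carrier M. h (a \<odot>\<^bsub>M\<^esub> x) = a \<odot>\<^bsub>N\<^esub> h x}"

definition frac_rel :: "('b, 'k) ring_scheme \<Rightarrow> 'b set \<Rightarrow> (('b \<times> 'b) \<times> ('b \<times> 'b)) set"
  where "frac_rel K U =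
    {((r, s), (r', s')). (r, s) \<in> carrier K \<times> U \<and> (r', s') \<in> carrier K \<times> U \<and>
       (\<exists>t\<in>U. t \<otimes>\<^bsub>K\<^esub> (r \<otimes>\<^bsub>K\<^esub> s') = t \<otimes>\<^bsub>K\<^esub> (r' \<otimes>\<^bsub>K\<^esub> s))}"

definition fraction :: "('b, 'k) ring_scheme \<Rightarrow> 'b set \<Rightarrow> 'b \<Rightarrow> 'b \<Rightarrow> ('b \<times> 'b) set"
  where "fraction K U r s = frac_rel K U `` {(r, s)}"

text \<open>The fraction ring of an algebra \<open>K\<close> with respect to \<open>U\<close>, with its induced algebra structure.
  The unions combine the results over all choices of representatives; as these results all
  coincide, each union is a single equivalence class.\<close>

definition frac_algebra :: "('a, 'b, 'k) module_scheme \<Rightarrow> 'b set \<Rightarrow> ('a, ('b \<times> 'b) set) module"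
  where "frac_algebra K U =
    \<lparr>carrier = (carrier K \<times> U) // frac_rel K U,
     monoid.mult = (\<lambda>X Y. \<Union>(r, s)\<in>X. \<Union>(r', s')\<in>Y. fraction K U (r \<otimes>\<^bsub>K\<^esub> r') (s \<otimes>\<^bsub>K\<^esub> s')),
     one = fraction K U \<one>\<^bsub>K\<^esub> \<one>\<^bsub>K\<^esub>,
     zero = fraction K U \<zero>\<^bsub>K\<^esub> \<one>\<^bsub>K\<^esub>,
     add = (\<lambda>X Y. \<Union>(r, s)\<in>X. \<Union>(r', s')\<in>Y.
              fraction K U ((r \<otimes>\<^bsub>K\<^esub> s') \<oplus>\<^bsub>K\<^esub> (r' \<otimes>\<^bsub>K\<^esub> s)) (s \<otimes>\<^bsub>K\<^esub> s')),
     smult = (\<lambda>a X. \<Union>(r, s)\<in>X. fraction K U (a \<odot>\<^bsub>K\<^esub> r) s)\<rparr>"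

definition to_frac :: "('b, 'k) ring_scheme \<Rightarrow> 'b set \<Rightarrow> 'b \<Rightarrow> ('b \<times> 'b) set"
  where "to_frac K U r = fraction K U r \<one>\<^bsub>K\<^esub>"

text \<open>The monoid algebra \<open>A[M]\<close>: the free \<open>A\<close>-module on the carrier of \<open>M\<close>, realised as
  functions of finite support, with convolution as product.\<close>

definition monoid_algebra ::
  "('a, 'm) ring_scheme \<Rightarrow> ('g, 'k) monoid_scheme \<Rightarrow> ('a, 'g \<Rightarrow> 'a) module"
  where "monoid_algebra A M =
    \<lparr>carrier = {f. (\<forall>x. f x \<in> carrier A) \<and> (\<forall>x. x \<notin> carrier M \<longrightarrow> f x = \<zero>\<^bsub>A\<^esub>) \<and>
                   finite {x. f x \<noteq> \<zero>\<^bsub>A\<^esub>}},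
     monoid.mult = (\<lambda>f g z. \<Oplus>\<^bsub>A\<^esub>p\<in>{(x, y). f x \<noteq> \<zero>\<^bsub>A\<^esub> \<and> g y \<noteq> \<zero>\<^bsub>A\<^esub> \<and> x \<otimes>\<^bsub>M\<^esub> y = z}.
              f (fst p) \<otimes>\<^bsub>A\<^esub> g (snd p)),
     one = (\<lambda>z. if z = \<one>\<^bsub>M\<^esub> then \<one>\<^bsub>A\<^esub> else \<zero>\<^bsub>A\<^esub>),
     zero = (\<lambda>z. \<zero>\<^bsub>A\<^esub>),
     add = (\<lambda>f g z. f z \<oplus>\<^bsub>A\<^esub> g z),
     smult = (\<lambda>a f z. a \<otimes>\<^bsub>A\<^esub> f z)\<rparr>"

definition basis_elt :: "('a, 'm) ring_scheme \<Rightarrow> 'g \<Rightarrow> 'g \<Rightarrow> 'a"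
  where "basis_elt A x = (\<lambda>z. if z = x then \<one>\<^bsub>A\<^esub> else \<zero>\<^bsub>A\<^esub>)"

text \<open>The free \<open>A\<close>-module on \<open>n\<close>-tuples of elements of \<open>K\<close>, with the componentwise product of
  tuples. A tuple is an extensional function on \<open>{..<n}\<close>.\<close>

definition tuple_algebra ::
  "('a, 'm) ring_scheme \<Rightarrow> nat \<Rightarrow> ('b, 'k) monoid_scheme \<Rightarrow> ('a, (nat \<Rightarrow> 'b) \<Rightarrow> 'a) module"
  where "tuple_algebra A n K = monoid_algebra A (product_group {..<n} (\<lambda>_. K))"

definition additivity_relations ::
  "('a, 'm) ring_scheme \<Rightarrow> nat \<Rightarrow> ('a, 'b, 'k) module_scheme \<Rightarrow> ((nat \<Rightarrow> 'b) \<Rightarrow> 'a) set"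
  where "additivity_relations A n K =
    {basis_elt A (x(i := b \<oplus>\<^bsub>K\<^esub> c)) \<ominus>\<^bsub>tuple_algebra A n K\<^esub>
       (basis_elt A (x(i := b)) \<oplus>\<^bsub>tuple_algebra A n K\<^esub> basis_elt A (x(i := c))) | x i b c.
     x \<in> {..<n} \<rightarrow>\<^sub>E carrier K \<and> i < n \<and> b \<in> carrier K \<and> c \<in> carrier K}"

definition homogeneity_relations ::
  "('a, 'm) ring_scheme \<Rightarrow> nat \<Rightarrow> ('a, 'b, 'k) module_scheme \<Rightarrow> ((nat \<Rightarrow> 'b) \<Rightarrow> 'a) set"
  where "homogeneity_relations A n K =
    {basis_elt A (x(i := a \<odot>\<^bsub>K\<^esub> b)) \<ominus>\<^bsub>tuple_algebra A n K\<^esub>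
       (a \<odot>\<^bsub>tuple_algebra A n K\<^esub> basis_elt A (x(i := b))) | x i a b.
     x \<in> {..<n} \<rightarrow>\<^sub>E carrier K \<and> i < n \<and> a \<in> carrier A \<and> b \<in> carrier K}"

text \<open>The product of a multilinearity relation with a basis element is again such a relation
  (\<open>K\<close> is commutative and an \<open>A\<close>-algebra), so the ideal generated by the relations is just their
  \<open>A\<close>-linear span, and the quotient below is the usual \<open>A\<close>-module \<open>K \<otimes>\<^sub>A \<dots> \<otimes>\<^sub>A K\<close> with the
  product determined by \<open>(x\<^sub>1 \<otimes> \<dots> \<otimes> x\<^sub>n) (y\<^sub>1 \<otimes> \<dots> \<otimes> y\<^sub>n) = x\<^sub>1 y\<^sub>1 \<otimes> \<dots> \<otimes> x\<^sub>n y\<^sub>n\<close>.\<close>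

definition multilinear_ideal ::
  "('a, 'm) ring_scheme \<Rightarrow> nat \<Rightarrow> ('a, 'b, 'k) module_scheme \<Rightarrow> ((nat \<Rightarrow> 'b) \<Rightarrow> 'a) set"
  where "multilinear_ideal A n K =
    Idl\<^bsub>tuple_algebra A n K\<^esub> (additivity_relations A n K \<union> homogeneity_relations A n K)"

definition tensor_power ::
  "('a, 'm) ring_scheme \<Rightarrow> nat \<Rightarrow> ('a, 'b, 'k) module_scheme
     \<Rightarrow> ('a, ((nat \<Rightarrow> 'b) \<Rightarrow> 'a) set) module"
  where "tensor_power A n K =
    ring.extend (tuple_algebra A n K Quot multilinear_ideal A n K)
      (module.fields (\<lambda>a X. \<Union>f\<in>X.
         multilinear_ideal A n K +>\<^bsub>tuple_algebra A n K\<^esub> (a \<odot>\<^bsub>tuple_algebra A n K\<^esub> f)))"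

text \<open>\<open>x 0 \<otimes> \<dots> \<otimes> x (n - 1)\<close>\<close>

definition pure_tensor ::
  "('a, 'm) ring_scheme \<Rightarrow> nat \<Rightarrow> ('a, 'b, 'k) module_scheme \<Rightarrow> (nat \<Rightarrow> 'b)
     \<Rightarrow> ((nat \<Rightarrow> 'b) \<Rightarrow> 'a) set"
  where "pure_tensor A n K x =
    multilinear_ideal A n K +>\<^bsub>tuple_algebra A n K\<^esub> basis_elt A (restrict x {..<n})"

text \<open>The map \<open>h \<otimes> \<dots> \<otimes> h\<close> induced by an algebra homomorphism \<open>h\<close> from \<open>K\<close> to \<open>L\<close>. Each
  representative \<open>f\<close> of a tensor \<open>X\<close> exhibits it as the linear combination of the pure tensors
  \<open>x 0 \<otimes> \<dots> \<otimes> x (n - 1)\<close> with coefficients \<open>f x\<close>; the image does not depend on \<open>f\<close>.\<close>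

definition tensor_power_map ::
  "('a, 'm) ring_scheme \<Rightarrow> nat \<Rightarrow> ('a, 'b, 'k) module_scheme \<Rightarrow> ('a, 'c, 'l) module_scheme
     \<Rightarrow> ('b \<Rightarrow> 'c) \<Rightarrow> ((nat \<Rightarrow> 'b) \<Rightarrow> 'a) set \<Rightarrow> ((nat \<Rightarrow> 'c) \<Rightarrow> 'a) set"
  where "tensor_power_map A n K L h X =
    (\<Union>f\<in>X. \<Oplus>\<^bsub>tensor_power A n L\<^esub>x\<in>{x. f x \<noteq> \<zero>\<^bsub>A\<^esub>}.
       f x \<odot>\<^bsub>tensor_power A n L\<^esub> pure_tensor A n L (h \<circ> x))"

text \<open>The action of a permutation \<open>\<sigma>\<close> of \<open>{..<n}\<close> on tensors. On representatives it sends the basis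
  element of a tuple \<open>x\<close> to that of \<open>x \<circ> inv \<sigma>\<close>, that is, it moves the \<open>i\<close>-th tensor factor to
  position \<open>\<sigma> i\<close>. The image of a coset of the (invariant) ideal of relations is again a coset.\<close>

definition permute_tensor ::
  "(nat \<Rightarrow> nat) \<Rightarrow> ((nat \<Rightarrow> 'b) \<Rightarrow> 'a) set \<Rightarrow> ((nat \<Rightarrow> 'b) \<Rightarrow> 'a) set"
  where "permute_tensor \<sigma> X = (\<lambda>f x. f (x \<circ> \<sigma>)) ` X"

definition symmetric_tensors ::
  "('a, 'm) ring_scheme \<Rightarrow> nat \<Rightarrow> ('a, 'b, 'k) module_scheme
     \<Rightarrow> ('a, ((nat \<Rightarrow> 'b) \<Rightarrow> 'a) set) module"
  where "symmetric_tensors A n K =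
    (tensor_power A n K)
      \<lparr>carrier := {X \<in> carrier (tensor_power A n K).
                    \<forall>\<sigma>. \<sigma> permutes {..<n} \<longrightarrow> permute_tensor \<sigma> X = X}\<rparr>"

definition diagonal_tensors ::
  "('a, 'm) ring_scheme \<Rightarrow> nat \<Rightarrow> ('a, 'b, 'k) module_scheme \<Rightarrow> 'b set
     \<Rightarrow> ((nat \<Rightarrow> 'b) \<Rightarrow> 'a) set set"
  where "diagonal_tensors A n K U = {pure_tensor A n K (\<lambda>_. f) | f. f \<in> U}"

end

theory Submission
  imports Defs
begin

text \<open>Let \<open>T\<close> be the \<open>n\<close>-fold tensor power of \<open>K\<close>, let \<open>T'\<close> be that of \<open>K\<^sub>U\<close>, and let \<open>F\<close> from \<open>T\<close> to
\<open>T'\<close> be the \<open>n\<close>-fold tensor power of the canonical map from \<open>K\<close> to \<open>K\<^sub>U\<close>. The idea is that \<open>F\<close>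
makes \<open>T'\<close> the localization of \<open>T\<close> at the diagonal tensors \<open>f \<otimes> \<dots> \<otimes> f\<close>, and that forming
invariants under a finite group commutes with localization at invariant elements.

A homomorphism is a localization map, up to a unique isomorphism, if it sends the denominators to
units, if every element of its kernel is killed by a denominator, and if every element of the
target can be multiplied into its image by the image of a denominator
(\<open>localization_criterion\<close>). These conditions are verified for the restriction of \<open>F\<close> to
symmetric tensors.

\<^item> The tensor with all entries \<open>f/1\<close> has the inverse with all entries \<open>1/f\<close> (\<open>diagonal_unit\<close>).

\<^item> The kernel of \<open>F\<close> is found without any analysis of the multilinear relations over \<open>K\<^sub>U\<close>. Let \<open>W\<close>
  be the set of all pure tensors with entries in \<open>U\<close>. Sending a tuple of fractions \<open>r\<^sub>i/s\<^sub>i\<close> to the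
  single fraction of \<open>\<Otimes> r\<^sub>i\<close> by \<open>\<Otimes> s\<^sub>i\<close> is multilinear and multiplicative, so it induces a
  homomorphism from \<open>T'\<close> to \<open>T\<^sub>W\<close> (\<open>multiplicative_multilinear\<close>). Composed with \<open>F\<close> it is the
  canonical map from \<open>T\<close> to \<open>T\<^sub>W\<close>, as is seen on pure tensors (\<open>gather_hom\<close>). Therefore \<open>F X = 0\<close>
  implies that some \<open>w\<close> in \<open>W\<close> kills \<open>X\<close>, and every \<open>w\<close> divides a diagonal tensor
  (\<open>hom_kernel\<close>).

\<^item> A linear combination \<open>Y\<close> of pure tensors of fractions is a tensor \<open>F X\<close> divided by the image of a
  diagonal one (\<open>clear_denominators_diagonal\<close>). If \<open>Y\<close> is symmetric, then \<open>X\<close> differs from each of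
  its permutations by an element of the kernel of \<open>F\<close>; one diagonal tensor kills all these finitely
  many differences, and its product with \<open>X\<close> is symmetric (\<open>clear_denominators_symmetric\<close>).

The statement about polynomials is the case where \<open>K\<close> is the polynomial ring.\<close>

section \<open>Algebra homomorphisms\<close>

definition alg_hom ::
  "('a, 'm) ring_scheme \<Rightarrow> ('a, 'b, 'k) module_scheme \<Rightarrow> ('a, 'c, 'l) module_scheme \<Rightarrow> ('b \<Rightarrow> 'c) set"
  where "alg_hom A M N =
    {h \<in> ring_hom M N. \<forall>a\<in>carrier A. \<forall>x\<in>carrier M. h (a \<odot>\<^bsub>M\<^esub> x) = a \<odot>\<^bsub>N\<^esub> h x}"

lemma alg_homI:
  assumes "\<And>x. x \<in> carrier M \<Longrightarrow> h x \<in> carrier N"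
    and "\<And>x y. x \<in> carrier M \<Longrightarrow> y \<in> carrier M \<Longrightarrow> h (x \<otimes>\<^bsub>M\<^esub> y) = h x \<otimes>\<^bsub>N\<^esub> h y"
    and "\<And>x y. x \<in> carrier M \<Longrightarrow> y \<in> carrier M \<Longrightarrow> h (x \<oplus>\<^bsub>M\<^esub> y) = h x \<oplus>\<^bsub>N\<^esub> h y"
    and "h \<one>\<^bsub>M\<^esub> = \<one>\<^bsub>N\<^esub>"
    and "\<And>a x. a \<in> carrier A \<Longrightarrow> x \<in> carrier M \<Longrightarrow> h (a \<odot>\<^bsub>M\<^esub> x) = a \<odot>\<^bsub>N\<^esub> h x"
  shows "h \<in> alg_hom A M N"
  using assms unfolding alg_hom_def by (auto intro!: ring_hom_memI)

lemma alg_homD: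
  assumes "h \<in> alg_hom A M N"
  shows "\<And>x. x \<in> carrier M \<Longrightarrow> h x \<in> carrier N"
    and "\<And>x y. x \<in> carrier M \<Longrightarrow> y \<in> carrier M \<Longrightarrow> h (x \<otimes>\<^bsub>M\<^esub> y) = h x \<otimes>\<^bsub>N\<^esub> h y"
    and "\<And>x y. x \<in> carrier M \<Longrightarrow> y \<in> carrier M \<Longrightarrow> h (x \<oplus>\<^bsub>M\<^esub> y) = h x \<oplus>\<^bsub>N\<^esub> h y"
    and "h \<one>\<^bsub>M\<^esub> = \<one>\<^bsub>N\<^esub>"
    and "\<And>a x. a \<in> carrier A \<Longrightarrow> x \<in> carrier M \<Longrightarrow> h (a \<odot>\<^bsub>M\<^esub> x) = a \<odot>\<^bsub>N\<^esub> h x"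
  using assms unfolding alg_hom_def by (auto simp: ring_hom_def)

lemma alg_hom_ring_hom_cring:
  assumes "h \<in> alg_hom A M N" "algebra A M" "algebra A N"
  shows "ring_hom_cring M N h"
  using assms algebra.M_cring[OF assms(2)] algebra.M_cring[OF assms(3)] unfolding alg_hom_def
  by (auto intro!: ring_hom_cring.intro ring_hom_cring_axioms.intro)

lemma alg_hom_comp:
  assumes "f \<in> alg_hom A L M" "g \<in> alg_hom A M N"
  shows "g \<circ> f \<in> alg_hom A L N"
  by (rule alg_homI) (simp_all add: alg_homD[OF assms(1)] alg_homD[OF assms(2)])

section \<open>Fraction rings\<close>

locale algebra_localization =
  fixes A :: "('a, 'm) ring_scheme" and K :: "('a, 'b, 'k) module_scheme" and U :: "'b set"
  assumes alg: "algebra A K" and subm: "submonoid U K"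
begin

sublocale A: cring A by (rule algebra.R_cring[OF alg])
sublocale K: cring K by (rule algebra.M_cring[OF alg])
sublocale K_alg: algebra A K by (rule alg)
sublocale U: submonoid U K by (rule subm)

abbreviation frac (infixl \<open>\<oslash>\<close> 70) where "frac \<equiv> fraction K U"
abbreviation Q where "Q \<equiv> frac_algebra K U"

lemma U_carrier [simp, intro]: "u \<in> U \<Longrightarrow> u \<in> carrier K"
  by (rule U.mem_carrier)

lemma U_mult [simp, intro]: "u \<in> U \<Longrightarrow> v \<in> U \<Longrightarrow> u \<otimes>\<^bsub>K\<^esub> v \<in> U"
  by (rule U.m_closed)

lemma frac_rel_equiv: "equiv (carrier K \<times> U) (frac_rel K U)"
proof (rule equivI)
  show "frac_rel K U \<subseteq> (carrier K \<times> U) \<times> (carrier K \<times> U)"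
    unfolding frac_rel_def by auto
  show "refl_on (carrier K \<times> U) (frac_rel K U)"
    unfolding frac_rel_def refl_on_def using U.one_closed by auto
  show "sym (frac_rel K U)"
    unfolding frac_rel_def sym_def by (auto dest: sym)
  show "trans (frac_rel K U)"
  proof (rule transI)
    fix p q z assume "(p, q) \<in> frac_rel K U" "(q, z) \<in> frac_rel K U"
    then obtain r s r' s' r'' s'' t t' where
      eq: "p = (r, s)" "q = (r', s')" "z = (r'', s'')" and
      c [simp]: "r \<in> carrier K" "r' \<in> carrier K" "r'' \<in> carrier K" and
      u [simp]: "s \<in> U" "s' \<in> U" "s'' \<in> U" "t \<in> U" "t' \<in> U" and
      e: "t \<otimes>\<^bsub>K\<^esub> (r \<otimes>\<^bsub>K\<^esub> s') = t \<otimes>\<^bsub>K\<^esub> (r' \<otimes>\<^bsub>K\<^esub> s)"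
         "t' \<otimes>\<^bsub>K\<^esub> (r' \<otimes>\<^bsub>K\<^esub> s'') = t' \<otimes>\<^bsub>K\<^esub> (r'' \<otimes>\<^bsub>K\<^esub> s')"
      unfolding frac_rel_def by blast
    \<comment> \<open>The two witnesses have to be multiplied by the middle denominator, since it need not be
      cancellable.\<close>
    have "(t \<otimes>\<^bsub>K\<^esub> t' \<otimes>\<^bsub>K\<^esub> s') \<otimes>\<^bsub>K\<^esub> (r \<otimes>\<^bsub>K\<^esub> s'') = (t' \<otimes>\<^bsub>K\<^esub> s'') \<otimes>\<^bsub>K\<^esub> (t \<otimes>\<^bsub>K\<^esub> (r \<otimes>\<^bsub>K\<^esub> s'))"
      by (simp add: K.m_ac)
    also have "\<dots> = (t \<otimes>\<^bsub>K\<^esub> s) \<otimes>\<^bsub>K\<^esub> (t' \<otimes>\<^bsub>K\<^esub> (r' \<otimes>\<^bsub>K\<^esub> s''))"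
      unfolding e(1) by (simp add: K.m_ac)
    also have "\<dots> = (t \<otimes>\<^bsub>K\<^esub> t' \<otimes>\<^bsub>K\<^esub> s') \<otimes>\<^bsub>K\<^esub> (r'' \<otimes>\<^bsub>K\<^esub> s)"
      unfolding e(2) by (simp add: K.m_ac)
    finally show "(p, z) \<in> frac_rel K U"
      unfolding frac_rel_def eq by (auto intro!: bexI[of _ "t \<otimes>\<^bsub>K\<^esub> t' \<otimes>\<^bsub>K\<^esub> s'"])
  qed
qed

lemma frac_eq_iff:
  assumes "r \<in> carrier K" "s \<in> U" "r' \<in> carrier K" "s' \<in> U"
  shows "r \<oslash> s = r' \<oslash> s' \<longleftrightarrow> (\<exists>t\<in>U. t \<otimes>\<^bsub>K\<^esub> (r \<otimes>\<^bsub>K\<^esub> s') = t \<otimes>\<^bsub>K\<^esub> (r' \<otimes>\<^bsub>K\<^esub> s))"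
proof -
  have "r \<oslash> s = r' \<oslash> s' \<longleftrightarrow> ((r, s), (r', s')) \<in> frac_rel K U"
    unfolding fraction_def by (rule eq_equiv_class_iff[OF frac_rel_equiv]) (use assms in auto)
  then show ?thesis using assms by (simp add: frac_rel_def)
qed

lemma frac_eqI:
  assumes "r \<in> carrier K" "s \<in> U" "r' \<in> carrier K" "s' \<in> U" "r \<otimes>\<^bsub>K\<^esub> s' = r' \<otimes>\<^bsub>K\<^esub> s"
  shows "r \<oslash> s = r' \<oslash> s'"
  using assms U.one_closed by (auto simp: frac_eq_iff)

lemma frac_closed [simp, intro]: "r \<in> carrier K \<Longrightarrow> s \<in> U \<Longrightarrow> r \<oslash> s \<in> carrier Q"
  by (auto simp: frac_algebra_def fraction_def intro: quotientI)

lemma frac_cases: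
  assumes "X \<in> carrier Q"
  obtains r s where "r \<in> carrier K" "s \<in> U" "X = r \<oslash> s"
  using assms by (auto simp: frac_algebra_def fraction_def elim!: quotientE)

lemma frac_mult [simp]:
  assumes "r \<in> carrier K" "s \<in> U" "r' \<in> carrier K" "s' \<in> U"
  shows "(r \<oslash> s) \<otimes>\<^bsub>Q\<^esub> (r' \<oslash> s') = (r \<otimes>\<^bsub>K\<^esub> r') \<oslash> (s \<otimes>\<^bsub>K\<^esub> s')"
proof -
  have "congruent2 (frac_rel K U) (frac_rel K U) (\<lambda>(r, s) (r', s'). (r \<otimes>\<^bsub>K\<^esub> r') \<oslash> (s \<otimes>\<^bsub>K\<^esub> s'))"
  proof (rule congruent2I', goal_cases)
    case (1 p1 p2 q1 q2)
    then obtain r s r' s' t x y x' y' t' where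
      eq: "p1 = (r, s)" "p2 = (r', s')" "q1 = (x, y)" "q2 = (x', y')" and
      [simp]: "r \<in> carrier K" "r' \<in> carrier K" "x \<in> carrier K" "x' \<in> carrier K"
        "s \<in> U" "s' \<in> U" "y \<in> U" "y' \<in> U" "t \<in> U" "t' \<in> U" and
      e: "t \<otimes>\<^bsub>K\<^esub> (r \<otimes>\<^bsub>K\<^esub> s') = t \<otimes>\<^bsub>K\<^esub> (r' \<otimes>\<^bsub>K\<^esub> s)"
         "t' \<otimes>\<^bsub>K\<^esub> (x \<otimes>\<^bsub>K\<^esub> y') = t' \<otimes>\<^bsub>K\<^esub> (x' \<otimes>\<^bsub>K\<^esub> y)"
      unfolding frac_rel_def by blast
    have "(t \<otimes>\<^bsub>K\<^esub> t') \<otimes>\<^bsub>K\<^esub> ((r \<otimes>\<^bsub>K\<^esub> x) \<otimes>\<^bsub>K\<^esub> (s' \<otimes>\<^bsub>K\<^esub> y'))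
        = (t \<otimes>\<^bsub>K\<^esub> (r \<otimes>\<^bsub>K\<^esub> s')) \<otimes>\<^bsub>K\<^esub> (t' \<otimes>\<^bsub>K\<^esub> (x \<otimes>\<^bsub>K\<^esub> y'))"
      by (simp add: K.m_ac)
    also have "\<dots> = (t \<otimes>\<^bsub>K\<^esub> t') \<otimes>\<^bsub>K\<^esub> ((r' \<otimes>\<^bsub>K\<^esub> x') \<otimes>\<^bsub>K\<^esub> (s \<otimes>\<^bsub>K\<^esub> y))"
      unfolding e by (simp add: K.m_ac)
    finally show ?case
      unfolding eq by (auto simp: frac_eq_iff intro!: bexI[of _ "t \<otimes>\<^bsub>K\<^esub> t'"])
  qed
  from UN_equiv_class2[OF frac_rel_equiv frac_rel_equiv this] assms show ?thesis
    by (simp add: frac_algebra_def fraction_def case_prod_unfold)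
qed

lemma frac_add [simp]:
  assumes "r \<in> carrier K" "s \<in> U" "r' \<in> carrier K" "s' \<in> U"
  shows "(r \<oslash> s) \<oplus>\<^bsub>Q\<^esub> (r' \<oslash> s') = ((r \<otimes>\<^bsub>K\<^esub> s') \<oplus>\<^bsub>K\<^esub> (r' \<otimes>\<^bsub>K\<^esub> s)) \<oslash> (s \<otimes>\<^bsub>K\<^esub> s')"
proof -
  have "congruent2 (frac_rel K U) (frac_rel K U)
     (\<lambda>(r, s) (r', s'). ((r \<otimes>\<^bsub>K\<^esub> s') \<oplus>\<^bsub>K\<^esub> (r' \<otimes>\<^bsub>K\<^esub> s)) \<oslash> (s \<otimes>\<^bsub>K\<^esub> s'))"
  proof (rule congruent2I', goal_cases)
    case (1 p1 p2 q1 q2)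
    then obtain r s r' s' t x y x' y' t' where
      eq: "p1 = (r, s)" "p2 = (r', s')" "q1 = (x, y)" "q2 = (x', y')" and
      [simp]: "r \<in> carrier K" "r' \<in> carrier K" "x \<in> carrier K" "x' \<in> carrier K"
        "s \<in> U" "s' \<in> U" "y \<in> U" "y' \<in> U" "t \<in> U" "t' \<in> U" and
      e: "t \<otimes>\<^bsub>K\<^esub> (r \<otimes>\<^bsub>K\<^esub> s') = t \<otimes>\<^bsub>K\<^esub> (r' \<otimes>\<^bsub>K\<^esub> s)"
         "t' \<otimes>\<^bsub>K\<^esub> (x \<otimes>\<^bsub>K\<^esub> y') = t' \<otimes>\<^bsub>K\<^esub> (x' \<otimes>\<^bsub>K\<^esub> y)"
      unfolding frac_rel_def by blast
    have "(t \<otimes>\<^bsub>K\<^esub> t') \<otimes>\<^bsub>K\<^esub> (((r \<otimes>\<^bsub>K\<^esub> y) \<oplus>\<^bsub>K\<^esub> (x \<otimes>\<^bsub>K\<^esub> s)) \<otimes>\<^bsub>K\<^esub> (s' \<otimes>\<^bsub>K\<^esub> y'))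
        = (t' \<otimes>\<^bsub>K\<^esub> y \<otimes>\<^bsub>K\<^esub> y') \<otimes>\<^bsub>K\<^esub> (t \<otimes>\<^bsub>K\<^esub> (r \<otimes>\<^bsub>K\<^esub> s')) \<oplus>\<^bsub>K\<^esub> (t \<otimes>\<^bsub>K\<^esub> s \<otimes>\<^bsub>K\<^esub> s') \<otimes>\<^bsub>K\<^esub> (t' \<otimes>\<^bsub>K\<^esub> (x \<otimes>\<^bsub>K\<^esub> y'))"
      by (simp add: K.l_distr K.r_distr K.m_ac)
    also have "\<dots> = (t \<otimes>\<^bsub>K\<^esub> t') \<otimes>\<^bsub>K\<^esub> (((r' \<otimes>\<^bsub>K\<^esub> y') \<oplus>\<^bsub>K\<^esub> (x' \<otimes>\<^bsub>K\<^esub> s')) \<otimes>\<^bsub>K\<^esub> (s \<otimes>\<^bsub>K\<^esub> y))"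
      unfolding e by (simp add: K.l_distr K.r_distr K.m_ac)
    finally show ?case
      unfolding eq by (auto simp: frac_eq_iff intro!: bexI[of _ "t \<otimes>\<^bsub>K\<^esub> t'"])
  qed
  from UN_equiv_class2[OF frac_rel_equiv frac_rel_equiv this] assms show ?thesis
    by (simp add: frac_algebra_def fraction_def case_prod_unfold)
qed

lemma frac_smult [simp]:
  assumes "a \<in> carrier A" "r \<in> carrier K" "s \<in> U"
  shows "a \<odot>\<^bsub>Q\<^esub> (r \<oslash> s) = (a \<odot>\<^bsub>K\<^esub> r) \<oslash> s"
proof -
  have "congruent (frac_rel K U) (\<lambda>(r, s). (a \<odot>\<^bsub>K\<^esub> r) \<oslash> s)"
  proof (rule congruentI)
    fix p q assume "(p, q) \<in> frac_rel K U"
    then obtain r s r' s' t where eq: "p = (r, s)" "q = (r', s')" and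
      c: "r \<in> carrier K" "r' \<in> carrier K" "s \<in> U" "s' \<in> U" "t \<in> U" and
      e: "t \<otimes>\<^bsub>K\<^esub> (r \<otimes>\<^bsub>K\<^esub> s') = t \<otimes>\<^bsub>K\<^esub> (r' \<otimes>\<^bsub>K\<^esub> s)"
      unfolding frac_rel_def by blast
    have *: "t \<otimes>\<^bsub>K\<^esub> ((a \<odot>\<^bsub>K\<^esub> x) \<otimes>\<^bsub>K\<^esub> y) = a \<odot>\<^bsub>K\<^esub> (t \<otimes>\<^bsub>K\<^esub> (x \<otimes>\<^bsub>K\<^esub> y))"
      if "x \<in> carrier K" "y \<in> carrier K" for x y
      using that c assms by (simp add: K_alg.smult_assoc2 K.m_comm[of t])
    show "(case p of (r, s) \<Rightarrow> (a \<odot>\<^bsub>K\<^esub> r) \<oslash> s) = (case q of (r, s) \<Rightarrow> (a \<odot>\<^bsub>K\<^esub> r) \<oslash> s)"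
      using c e assms by (auto simp: eq frac_eq_iff * intro!: bexI[of _ t])
  qed
  from UN_equiv_class[OF frac_rel_equiv this] assms show ?thesis
    by (simp add: frac_algebra_def fraction_def)
qed

lemma frac_one: "\<one>\<^bsub>Q\<^esub> = \<one>\<^bsub>K\<^esub> \<oslash> \<one>\<^bsub>K\<^esub>" and frac_zero: "\<zero>\<^bsub>Q\<^esub> = \<zero>\<^bsub>K\<^esub> \<oslash> \<one>\<^bsub>K\<^esub>"
  by (simp_all add: frac_algebra_def)

lemma Q_cring: "cring Q"
proof (rule cringI)
  show "abelian_group Q"
  proof (rule abelian_groupI)
    fix x y z assume "x \<in> carrier Q" "y \<in> carrier Q" "z \<in> carrier Q"
    then show "x \<oplus>\<^bsub>Q\<^esub> y \<oplus>\<^bsub>Q\<^esub> z = x \<oplus>\<^bsub>Q\<^esub> (y \<oplus>\<^bsub>Q\<^esub> z)"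
      by (elim frac_cases) (simp add: K.l_distr K.r_distr K.m_ac K.a_ac)
  next
    fix x assume "x \<in> carrier Q"
    then obtain r s where x: "r \<in> carrier K" "s \<in> U" "x = r \<oslash> s" by (rule frac_cases)
    then have "(\<ominus>\<^bsub>K\<^esub> r) \<oslash> s \<oplus>\<^bsub>Q\<^esub> x = (\<zero>\<^bsub>K\<^esub>) \<oslash> (s \<otimes>\<^bsub>K\<^esub> s)"
      by (simp add: K.l_minus K.l_neg)
    also have "\<dots> = \<zero>\<^bsub>Q\<^esub>"
      unfolding frac_zero by (rule frac_eqI) (simp_all add: x U.one_closed)
    finally show "\<exists>y\<in>carrier Q. y \<oplus>\<^bsub>Q\<^esub> x = \<zero>\<^bsub>Q\<^esub>"
      using x by (intro bexI[of _ "(\<ominus>\<^bsub>K\<^esub> r) \<oslash> s"]) simp_all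
  next
    fix x y assume "x \<in> carrier Q" "y \<in> carrier Q"
    then show "x \<oplus>\<^bsub>Q\<^esub> y \<in> carrier Q" by (elim frac_cases) simp
    from \<open>x \<in> carrier Q\<close> \<open>y \<in> carrier Q\<close> show "x \<oplus>\<^bsub>Q\<^esub> y = y \<oplus>\<^bsub>Q\<^esub> x"
      by (elim frac_cases) (simp add: K.a_comm K.m_comm)
    from \<open>x \<in> carrier Q\<close> show "\<zero>\<^bsub>Q\<^esub> \<oplus>\<^bsub>Q\<^esub> x = x"
      by (elim frac_cases) (simp add: frac_zero U.one_closed)
  qed (simp add: frac_zero U.one_closed)
  show "comm_monoid Q"
  proof (rule comm_monoidI)
    fix x y z assume "x \<in> carrier Q" "y \<in> carrier Q" "z \<in> carrier Q"
    then show "x \<otimes>\<^bsub>Q\<^esub> y \<otimes>\<^bsub>Q\<^esub> z = x \<otimes>\<^bsub>Q\<^esub> (y \<otimes>\<^bsub>Q\<^esub> z)"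
      by (elim frac_cases) (simp add: K.m_assoc)
  next
    fix x y assume "x \<in> carrier Q" "y \<in> carrier Q"
    then show "x \<otimes>\<^bsub>Q\<^esub> y \<in> carrier Q" by (elim frac_cases) simp
    from \<open>x \<in> carrier Q\<close> \<open>y \<in> carrier Q\<close> show "x \<otimes>\<^bsub>Q\<^esub> y = y \<otimes>\<^bsub>Q\<^esub> x"
      by (elim frac_cases) (simp add: K.m_comm)
    from \<open>x \<in> carrier Q\<close> show "\<one>\<^bsub>Q\<^esub> \<otimes>\<^bsub>Q\<^esub> x = x"
      by (elim frac_cases) (simp add: frac_one U.one_closed)
  qed (simp add: frac_one U.one_closed)
  fix x y z assume "x \<in> carrier Q" "y \<in> carrier Q" "z \<in> carrier Q"
  then show "(x \<oplus>\<^bsub>Q\<^esub> y) \<otimes>\<^bsub>Q\<^esub> z = x \<otimes>\<^bsub>Q\<^esub> z \<oplus>\<^bsub>Q\<^esub> y \<otimes>\<^bsub>Q\<^esub> z"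
    by (elim frac_cases, simp, intro frac_eqI) (simp_all add: K.l_distr K.r_distr K.m_ac)
qed

lemma Q_algebra: "algebra A Q"
proof (rule algebraI)
  fix a b x assume "a \<in> carrier A" "b \<in> carrier A" "x \<in> carrier Q"
  then show "(a \<oplus>\<^bsub>A\<^esub> b) \<odot>\<^bsub>Q\<^esub> x = a \<odot>\<^bsub>Q\<^esub> x \<oplus>\<^bsub>Q\<^esub> b \<odot>\<^bsub>Q\<^esub> x"
    by (elim frac_cases, simp add: K_alg.smult_l_distr, intro frac_eqI)
       (simp_all add: K_alg.smult_assoc2 K.l_distr K.m_assoc)
next
  fix a x y assume "a \<in> carrier A" "x \<in> carrier Q" "y \<in> carrier Q"
  then show "a \<odot>\<^bsub>Q\<^esub> (x \<oplus>\<^bsub>Q\<^esub> y) = a \<odot>\<^bsub>Q\<^esub> x \<oplus>\<^bsub>Q\<^esub> a \<odot>\<^bsub>Q\<^esub> y"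
    by (elim frac_cases) (simp add: K_alg.smult_r_distr K_alg.smult_assoc2)
next
  fix a b x assume "a \<in> carrier A" "b \<in> carrier A" "x \<in> carrier Q"
  then show "(a \<otimes>\<^bsub>A\<^esub> b) \<odot>\<^bsub>Q\<^esub> x = a \<odot>\<^bsub>Q\<^esub> (b \<odot>\<^bsub>Q\<^esub> x)"
    by (elim frac_cases) (simp add: K_alg.smult_assoc1)
next
  fix a x y assume "a \<in> carrier A" "x \<in> carrier Q" "y \<in> carrier Q"
  then show "(a \<odot>\<^bsub>Q\<^esub> x) \<otimes>\<^bsub>Q\<^esub> y = a \<odot>\<^bsub>Q\<^esub> (x \<otimes>\<^bsub>Q\<^esub> y)"
    by (elim frac_cases) (simp add: K_alg.smult_assoc2)
next
  fix a x assume "a \<in> carrier A" "x \<in> carrier Q"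
  then show "a \<odot>\<^bsub>Q\<^esub> x \<in> carrier Q" by (elim frac_cases) simp
next
  fix x assume "x \<in> carrier Q"
  then show "\<one>\<^bsub>A\<^esub> \<odot>\<^bsub>Q\<^esub> x = x" by (elim frac_cases) simp
qed (rule A.cring_axioms Q_cring)+

lemma frac_add_same_denominator:
  assumes "r \<in> carrier K" "r' \<in> carrier K" "s \<in> U"
  shows "(r \<oslash> s) \<oplus>\<^bsub>Q\<^esub> (r' \<oslash> s) = (r \<oplus>\<^bsub>K\<^esub> r') \<oslash> s"
  using assms by (simp, intro frac_eqI) (simp_all add: K.l_distr K.m_assoc)

lemma to_frac_alg_hom: "to_frac K U \<in> alg_hom A K Q"
  by (rule alg_homI) (simp_all add: to_frac_def U.one_closed frac_one)

lemma to_frac_eq_zero: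
  assumes "x \<in> carrier K" "to_frac K U x = \<zero>\<^bsub>Q\<^esub>"
  shows "\<exists>u\<in>U. u \<otimes>\<^bsub>K\<^esub> x = \<zero>\<^bsub>K\<^esub>"
  using assms by (simp add: to_frac_def frac_zero frac_eq_iff U.one_closed)

text \<open>Multiplying up one factor at a time avoids products over index sets with a point removed.\<close>

lemma common_multiple:
  assumes "finite I" "\<And>i. i \<in> I \<Longrightarrow> w i \<in> U"
  shows "\<exists>u\<in>U. \<forall>i\<in>I. \<exists>c\<in>U. c \<otimes>\<^bsub>K\<^esub> w i = u"
  using assms
proof (induction I rule: finite_induct)
  case empty
  then show ?case using U.one_closed by blast
next
  case (insert i I)
  then obtain u where u: "u \<in> U" "\<forall>j\<in>I. \<exists>c\<in>U. c \<otimes>\<^bsub>K\<^esub> w j = u" by auto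
  have "\<exists>c\<in>U. c \<otimes>\<^bsub>K\<^esub> w j = u \<otimes>\<^bsub>K\<^esub> w i" if "j \<in> insert i I" for j
  proof (cases "j = i")
    case True
    then show ?thesis using u by blast
  next
    case False
    then have "j \<in> I" using that by simp
    then obtain c where c: "c \<in> U" "c \<otimes>\<^bsub>K\<^esub> w j = u" using u(2) by blast
    have [simp]: "w i \<in> U" "w j \<in> U" using insert.prems that by auto
    have "(w i \<otimes>\<^bsub>K\<^esub> c) \<otimes>\<^bsub>K\<^esub> w j = w i \<otimes>\<^bsub>K\<^esub> (c \<otimes>\<^bsub>K\<^esub> w j)"
      using c by (simp add: K.m_assoc)
    also have "\<dots> = u \<otimes>\<^bsub>K\<^esub> w i"
      unfolding c(2) using u(1) by (intro K.m_comm) auto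
    finally show ?thesis using c by (intro bexI[of _ "w i \<otimes>\<^bsub>K\<^esub> c"]) auto
  qed
  then show ?case using u insert.prems by (intro bexI[of _ "u \<otimes>\<^bsub>K\<^esub> w i"]) auto
qed

text \<open>An element \<open>y\<close> of \<open>R\<close> deserves to be called the image of \<open>r / s\<close> if \<open>h s \<cdot> y = h r\<close>. As \<open>h s\<close> is a
unit, there is exactly one such \<open>y\<close>, and it is the same for all representatives of the fraction.
Describing the map by this equation, and not by a choice of representatives and inverses, turns
each of its algebraic properties into a multiplication of such equations. The same equation
forces the values of any competitor, which gives uniqueness.\<close>

theorem localization_criterion:
  assumes R: "algebra A R" and h: "h \<in> alg_hom A K R"
    and units: "\<And>u. u \<in> U \<Longrightarrow> h u \<in> Units R"
    and ker: "\<And>x. x \<in> carrier K \<Longrightarrow> h x = \<zero>\<^bsub>R\<^esub> \<Longrightarrow> \<exists>u\<in>U. u \<otimes>\<^bsub>K\<^esub> x = \<zero>\<^bsub>K\<^esub>"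
    and surj: "\<And>y. y \<in> carrier R \<Longrightarrow> \<exists>x\<in>carrier K. \<exists>u\<in>U. h u \<otimes>\<^bsub>R\<^esub> y = h x"
  shows "\<exists>!\<phi>. \<phi> \<in> extensional (carrier Q) \<and> \<phi> \<in> alg_iso A Q R
    \<and> (\<forall>x\<in>carrier K. \<phi> (to_frac K U x) = h x)"
proof -
  interpret R: cring R using R by (rule algebra.M_cring)
  interpret R_alg: algebra A R by (rule R)
  interpret h: ring_hom_cring K R h by (rule alg_hom_ring_hom_cring[OF h alg R])
  define \<phi> where "\<phi> = (\<lambda>X\<in>carrier Q. SOME y. y \<in> carrier R \<and>
    (\<exists>r\<in>carrier K. \<exists>s\<in>U. X = r \<oslash> s \<and> h s \<otimes>\<^bsub>R\<^esub> y = h r))"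
  \<comment> \<open>Both sides agree after multiplication by the unit \<open>h (t \<cdot> s \<cdot> s')\<close>, where \<open>t\<close> witnesses
    the equality of the two fractions.\<close>
  have well_defined: "y = y'"
    if [simp]: "r \<in> carrier K" "s \<in> U" "r' \<in> carrier K" "s' \<in> U" "y \<in> carrier R" "y' \<in> carrier R"
      and eq: "r \<oslash> s = r' \<oslash> s'" and y: "h s \<otimes>\<^bsub>R\<^esub> y = h r" "h s' \<otimes>\<^bsub>R\<^esub> y' = h r'"
    for r s r' s' y y'
  proof -
    obtain t where [simp]: "t \<in> U" and t: "t \<otimes>\<^bsub>K\<^esub> (r \<otimes>\<^bsub>K\<^esub> s') = t \<otimes>\<^bsub>K\<^esub> (r' \<otimes>\<^bsub>K\<^esub> s)"
      using eq by (auto simp: frac_eq_iff)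
    have "h (t \<otimes>\<^bsub>K\<^esub> s \<otimes>\<^bsub>K\<^esub> s') \<otimes>\<^bsub>R\<^esub> y = h (t \<otimes>\<^bsub>K\<^esub> (r \<otimes>\<^bsub>K\<^esub> s'))"
      by (simp add: y(1)[symmetric] R.m_ac)
    also have "\<dots> = h (t \<otimes>\<^bsub>K\<^esub> s \<otimes>\<^bsub>K\<^esub> s') \<otimes>\<^bsub>R\<^esub> y'"
      unfolding t by (simp add: y(2)[symmetric] R.m_ac)
    finally have "h (t \<otimes>\<^bsub>K\<^esub> s \<otimes>\<^bsub>K\<^esub> s') \<otimes>\<^bsub>R\<^esub> y = h (t \<otimes>\<^bsub>K\<^esub> s \<otimes>\<^bsub>K\<^esub> s') \<otimes>\<^bsub>R\<^esub> y'" .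
    moreover have "h (t \<otimes>\<^bsub>K\<^esub> s \<otimes>\<^bsub>K\<^esub> s') \<in> Units R" by (intro units U_mult that \<open>t \<in> U\<close>)
    ultimately show "y = y'"
      using R.Units_l_cancel that by blast
  qed
  have \<phi>_eqI: "\<phi> (r \<oslash> s) = y"
    if "r \<in> carrier K" "s \<in> U" "y \<in> carrier R" "h s \<otimes>\<^bsub>R\<^esub> y = h r" for r s y
  proof -
    let ?P = "\<lambda>y. y \<in> carrier R \<and> (\<exists>r'\<in>carrier K. \<exists>s'\<in>U. r \<oslash> s = r' \<oslash> s' \<and> h s' \<otimes>\<^bsub>R\<^esub> y = h r')"
    have "?P (SOME y. ?P y)"
      by (rule someI[of ?P y]) (use that in blast)
    moreover have "\<phi> (r \<oslash> s) = (SOME y. ?P y)"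
      using that by (simp add: \<phi>_def)
    ultimately have "?P (\<phi> (r \<oslash> s))" by (simp only:)
    then obtain r' s' where "\<phi> (r \<oslash> s) \<in> carrier R" "r' \<in> carrier K" "s' \<in> U"
      "r \<oslash> s = r' \<oslash> s'" "h s' \<otimes>\<^bsub>R\<^esub> \<phi> (r \<oslash> s) = h r'"
      by blast
    with that show ?thesis
      by (intro well_defined[of r' s' r s "\<phi> (r \<oslash> s)" y]) simp_all
  qed
  have solvable: "\<exists>y\<in>carrier R. h s \<otimes>\<^bsub>R\<^esub> y = h r" if "r \<in> carrier K" "s \<in> U" for r s
  proof (intro bexI)
    have "h s \<otimes>\<^bsub>R\<^esub> (inv\<^bsub>R\<^esub> h s \<otimes>\<^bsub>R\<^esub> h r) = (h s \<otimes>\<^bsub>R\<^esub> inv\<^bsub>R\<^esub> h s) \<otimes>\<^bsub>R\<^esub> h r"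
      using that units[of s] by (simp add: R.m_assoc del: R.Units_r_inv)
    also have "\<dots> = h r" using that units[of s] by simp
    finally show "h s \<otimes>\<^bsub>R\<^esub> (inv\<^bsub>R\<^esub> h s \<otimes>\<^bsub>R\<^esub> h r) = h r" .
  qed (use that units[of s] in simp)
  have \<phi>_cases: "\<exists>r s y. r \<in> carrier K \<and> s \<in> U \<and> X = r \<oslash> s \<and> y \<in> carrier R \<and> h s \<otimes>\<^bsub>R\<^esub> y = h r \<and> \<phi> X = y"
    if "X \<in> carrier Q" for X
    using that solvable \<phi>_eqI by (metis frac_cases)
  have "\<phi> \<in> alg_hom A Q R"
  proof (rule alg_homI)
    fix X assume "X \<in> carrier Q"
    then show "\<phi> X \<in> carrier R" using \<phi>_cases by blast
  next
    fix X Y assume X: "X \<in> carrier Q" and Y: "Y \<in> carrier Q"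
    obtain r s x where [simp]: "r \<in> carrier K" "s \<in> U" "x \<in> carrier R" "\<phi> X = x"
      and X_eq: "X = r \<oslash> s" and x: "h s \<otimes>\<^bsub>R\<^esub> x = h r"
      using \<phi>_cases[OF X] by blast
    obtain r' s' y where [simp]: "r' \<in> carrier K" "s' \<in> U" "y \<in> carrier R" "\<phi> Y = y"
      and Y_eq: "Y = r' \<oslash> s'" and y: "h s' \<otimes>\<^bsub>R\<^esub> y = h r'"
      using \<phi>_cases[OF Y] by blast
    have "\<phi> (X \<otimes>\<^bsub>Q\<^esub> Y) = x \<otimes>\<^bsub>R\<^esub> y"
      by (simp add: X_eq Y_eq \<phi>_eqI x[symmetric] y[symmetric] R.m_ac)
    then show "\<phi> (X \<otimes>\<^bsub>Q\<^esub> Y) = \<phi> X \<otimes>\<^bsub>R\<^esub> \<phi> Y" by simp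
    have "\<phi> (X \<oplus>\<^bsub>Q\<^esub> Y) = x \<oplus>\<^bsub>R\<^esub> y"
      by (simp add: X_eq Y_eq \<phi>_eqI x[symmetric] y[symmetric] R.m_ac R.l_distr R.r_distr)
    then show "\<phi> (X \<oplus>\<^bsub>Q\<^esub> Y) = \<phi> X \<oplus>\<^bsub>R\<^esub> \<phi> Y" by simp
  next
    show "\<phi> \<one>\<^bsub>Q\<^esub> = \<one>\<^bsub>R\<^esub>" by (simp add: frac_one U.one_closed \<phi>_eqI)
  next
    fix a X assume [simp]: "a \<in> carrier A" and X: "X \<in> carrier Q"
    obtain r s x where [simp]: "r \<in> carrier K" "s \<in> U" "x \<in> carrier R" "\<phi> X = x"
      and X_eq: "X = r \<oslash> s" and x: "h s \<otimes>\<^bsub>R\<^esub> x = h r"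
      using \<phi>_cases[OF X] by blast
    have "h s \<otimes>\<^bsub>R\<^esub> (a \<odot>\<^bsub>R\<^esub> x) = a \<odot>\<^bsub>R\<^esub> (h s \<otimes>\<^bsub>R\<^esub> x)"
      by (simp add: R.m_comm[of "h s"] R_alg.smult_assoc2)
    then have "\<phi> (a \<odot>\<^bsub>Q\<^esub> X) = a \<odot>\<^bsub>R\<^esub> x"
      by (simp add: X_eq \<phi>_eqI x alg_homD(5)[OF h])
    then show "\<phi> (a \<odot>\<^bsub>Q\<^esub> X) = a \<odot>\<^bsub>R\<^esub> \<phi> X" by simp
  qed
  moreover have "bij_betw \<phi> (carrier Q) (carrier R)"
  proof (rule bij_betw_imageI)
    interpret \<phi>: ring_hom_cring Q R \<phi>
      by (rule alg_hom_ring_hom_cring[OF \<open>\<phi> \<in> alg_hom A Q R\<close> Q_algebra R])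
    have "X = \<zero>\<^bsub>Q\<^esub>" if X: "X \<in> carrier Q" and 0: "\<phi> X = \<zero>\<^bsub>R\<^esub>" for X
    proof -
      obtain r s where rs: "r \<in> carrier K" "s \<in> U" "X = r \<oslash> s" and "h s \<otimes>\<^bsub>R\<^esub> \<zero>\<^bsub>R\<^esub> = h r"
        using \<phi>_cases[OF X] 0 by metis
      then have "h r = \<zero>\<^bsub>R\<^esub>" by (simp add: U_carrier)
      then show ?thesis
        using ker[of r] rs by (auto simp: frac_zero frac_eq_iff U.one_closed)
    qed
    then have "a_kernel Q R \<phi> = {\<zero>\<^bsub>Q\<^esub>}"
      unfolding a_kernel_def' using \<phi>.R.zero_closed \<phi>.hom_zero by blast
    then show "inj_on \<phi> (carrier Q)" by (rule \<phi>.ring.trivial_ker_imp_inj)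
    show "\<phi> ` carrier Q = carrier R"
    proof
      show "\<phi> ` carrier Q \<subseteq> carrier R" by auto
      show "carrier R \<subseteq> \<phi> ` carrier Q"
      proof
        fix y assume "y \<in> carrier R"
        with surj obtain x u where "x \<in> carrier K" "u \<in> U" "h u \<otimes>\<^bsub>R\<^esub> y = h x" by blast
        with \<open>y \<in> carrier R\<close> show "y \<in> \<phi> ` carrier Q"
          by (intro image_eqI[of _ _ "x \<oslash> u"]) (auto simp: \<phi>_eqI)
      qed
    qed
  qed
  ultimately have iso: "\<phi> \<in> alg_iso A Q R"
    by (auto simp: alg_hom_def alg_iso_def ring_iso_def)
  have on_K: "\<phi> (to_frac K U x) = h x" if "x \<in> carrier K" for x
    using that by (simp add: to_frac_def \<phi>_eqI U.one_closed)
  show ?thesis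
  proof (rule ex1I[of _ \<phi>])
    show "\<phi> \<in> extensional (carrier Q) \<and> \<phi> \<in> alg_iso A Q R
        \<and> (\<forall>x\<in>carrier K. \<phi> (to_frac K U x) = h x)"
      using iso on_K by (simp add: \<phi>_def)
  next
    fix \<psi> assume \<psi>: "\<psi> \<in> extensional (carrier Q) \<and> \<psi> \<in> alg_iso A Q R
        \<and> (\<forall>x\<in>carrier K. \<psi> (to_frac K U x) = h x)"
    then have \<psi>_hom: "\<psi> \<in> ring_hom Q R"
      by (simp add: alg_iso_def ring_iso_def)
    have "\<psi> X = \<phi> X" if X: "X \<in> carrier Q" for X
    proof -
      obtain r s where rs [simp]: "r \<in> carrier K" "s \<in> U" and X_eq: "X = r \<oslash> s"
        using X by (rule frac_cases)
      have "to_frac K U s \<otimes>\<^bsub>Q\<^esub> X = to_frac K U r"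
        unfolding X_eq to_frac_def by (simp add: U.one_closed, intro frac_eqI) (simp_all add: U.one_closed K.m_comm)
      then have "h s \<otimes>\<^bsub>R\<^esub> \<psi> X = h r"
        using ring_hom_mult[OF \<psi>_hom, of "to_frac K U s" X] \<psi> X alg_homD(1)[OF to_frac_alg_hom]
        by simp
      then show ?thesis
        using \<phi>_eqI[of r s "\<psi> X"] ring_hom_closed[OF \<psi>_hom X] X_eq by simp
    qed
    then show "\<psi> = \<phi>"
      using \<psi> by (intro extensionalityI[of _ "carrier Q"]) (auto simp: \<phi>_def)
  qed
qed

end

section \<open>Monoid algebras\<close>

text \<open>In the monoid algebra this is the value at \<open>f\<close> of the linear map that sends the basis element of
\<open>x\<close> to \<open>\<phi> x\<close>. The expression in \<^const>\<open>tensor_power_map\<close> is an instance of it.\<close>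

definition linear_extension ::
  "('a, 'm) ring_scheme \<Rightarrow> ('a, 'b, 'k) module_scheme \<Rightarrow> ('g \<Rightarrow> 'b) \<Rightarrow> ('g \<Rightarrow> 'a) \<Rightarrow> 'b"
  where "linear_extension A R \<phi> f = (\<Oplus>\<^bsub>R\<^esub>x\<in>{x. f x \<noteq> \<zero>\<^bsub>A\<^esub>}. f x \<odot>\<^bsub>R\<^esub> \<phi> x)"

locale monoid_algebra_over =
  fixes A :: "('a, 'm) ring_scheme" and M :: "('g, 'k) monoid_scheme"
  assumes A_cring: "cring A" and M_comm: "comm_monoid M"
begin

sublocale A: cring A by (rule A_cring)
sublocale M: comm_monoid M by (rule M_comm)

abbreviation AM where "AM \<equiv> monoid_algebra A M"
abbreviation e where "e \<equiv> basis_elt A"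

lemma mem_carrier_AM:
  "f \<in> carrier AM \<longleftrightarrow> (\<forall>x. f x \<in> carrier A) \<and> (\<forall>x. x \<notin> carrier M \<longrightarrow> f x = \<zero>\<^bsub>A\<^esub>) \<and>
     finite {x. f x \<noteq> \<zero>\<^bsub>A\<^esub>}"
  by (simp add: monoid_algebra_def)

lemma AM_coeff_closed [simp, intro]: "f \<in> carrier AM \<Longrightarrow> f x \<in> carrier A"
  by (simp add: mem_carrier_AM)

lemma AM_support:
  assumes "f \<in> carrier AM"
  shows "finite {x. f x \<noteq> \<zero>\<^bsub>A\<^esub>}" "{x. f x \<noteq> \<zero>\<^bsub>A\<^esub>} \<subseteq> carrier M"
  using assms by (auto simp: mem_carrier_AM)

lemma AM_zero: "\<zero>\<^bsub>AM\<^esub> = (\<lambda>z. \<zero>\<^bsub>A\<^esub>)"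
  and AM_add: "f \<oplus>\<^bsub>AM\<^esub> g = (\<lambda>z. f z \<oplus>\<^bsub>A\<^esub> g z)"
  and AM_smult: "a \<odot>\<^bsub>AM\<^esub> f = (\<lambda>z. a \<otimes>\<^bsub>A\<^esub> f z)"
  and AM_one: "\<one>\<^bsub>AM\<^esub> = e \<one>\<^bsub>M\<^esub>"
  unfolding monoid_algebra_def basis_elt_def
  by (simp_all only: monoid.simps ring.simps module.simps)

lemma AM_apply: "(f \<oplus>\<^bsub>AM\<^esub> g) z = f z \<oplus>\<^bsub>A\<^esub> g z" "(a \<odot>\<^bsub>AM\<^esub> f) z = a \<otimes>\<^bsub>A\<^esub> f z"
  by (simp_all add: AM_add AM_smult)

text \<open>Summing over fixed finite sets that contain the supports, and not over the supports themselves,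
makes the index set independent of the factors, so that the product is visibly bilinear.\<close>

lemma AM_mult:
  assumes "f \<in> carrier AM" "g \<in> carrier AM" "finite S" "finite T"
    and "{x. f x \<noteq> \<zero>\<^bsub>A\<^esub>} \<subseteq> S" "{x. g x \<noteq> \<zero>\<^bsub>A\<^esub>} \<subseteq> T"
  shows "(f \<otimes>\<^bsub>AM\<^esub> g) z =
    (\<Oplus>\<^bsub>A\<^esub>p\<in>{p \<in> S \<times> T. fst p \<otimes>\<^bsub>M\<^esub> snd p = z}. f (fst p) \<otimes>\<^bsub>A\<^esub> g (snd p))"
proof -
  have "(f \<otimes>\<^bsub>AM\<^esub> g) z = (\<Oplus>\<^bsub>A\<^esub>p\<in>{(x, y). f x \<noteq> \<zero>\<^bsub>A\<^esub> \<and> g y \<noteq> \<zero>\<^bsub>A\<^esub> \<and> x \<otimes>\<^bsub>M\<^esub> y = z}.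
      f (fst p) \<otimes>\<^bsub>A\<^esub> g (snd p))"
    unfolding monoid_algebra_def by (simp only: monoid.simps)
  also have "\<dots> = (\<Oplus>\<^bsub>A\<^esub>p\<in>{p \<in> S \<times> T. fst p \<otimes>\<^bsub>M\<^esub> snd p = z}. f (fst p) \<otimes>\<^bsub>A\<^esub> g (snd p))"
  proof (rule A.add.finprod_mono_neutral_cong_left)
    show "finite {p \<in> S \<times> T. fst p \<otimes>\<^bsub>M\<^esub> snd p = z}" using assms by simp
    fix p assume "p \<in> {p \<in> S \<times> T. fst p \<otimes>\<^bsub>M\<^esub> snd p = z} -
      {(x, y). f x \<noteq> \<zero>\<^bsub>A\<^esub> \<and> g y \<noteq> \<zero>\<^bsub>A\<^esub> \<and> x \<otimes>\<^bsub>M\<^esub> y = z}"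
    then show "f (fst p) \<otimes>\<^bsub>A\<^esub> g (snd p) = \<zero>\<^bsub>A\<^esub>"
      using assms(1,2) by auto
  qed (use assms in auto)
  finally show ?thesis .
qed

lemma AM_zero_closed: "\<zero>\<^bsub>AM\<^esub> \<in> carrier AM"
  by (simp add: mem_carrier_AM AM_zero)

lemma basis_closed [simp, intro]: "x \<in> carrier M \<Longrightarrow> e x \<in> carrier AM"
  unfolding mem_carrier_AM basis_elt_def by (auto intro: rev_finite_subset[of "{x}"])

lemma AM_add_closed [simp, intro]:
  assumes "f \<in> carrier AM" "g \<in> carrier AM"
  shows "f \<oplus>\<^bsub>AM\<^esub> g \<in> carrier AM"
proof -
  have "finite {x. f x \<oplus>\<^bsub>A\<^esub> g x \<noteq> \<zero>\<^bsub>A\<^esub>}"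
    by (rule finite_subset[of _ "{x. f x \<noteq> \<zero>\<^bsub>A\<^esub>} \<union> {x. g x \<noteq> \<zero>\<^bsub>A\<^esub>}"])
       (use assms AM_support in auto)
  then show ?thesis using assms by (simp add: mem_carrier_AM AM_add)
qed

lemma AM_smult_closed [simp, intro]:
  assumes "a \<in> carrier A" "f \<in> carrier AM"
  shows "a \<odot>\<^bsub>AM\<^esub> f \<in> carrier AM"
proof -
  have "finite {x. a \<otimes>\<^bsub>A\<^esub> f x \<noteq> \<zero>\<^bsub>A\<^esub>}"
    by (rule finite_subset[of _ "{x. f x \<noteq> \<zero>\<^bsub>A\<^esub>}"]) (use assms AM_support in auto)
  then show ?thesis using assms by (simp add: mem_carrier_AM AM_smult)
qed

lemma AM_mult_closed [simp, intro]:
  assumes f: "f \<in> carrier AM" and g: "g \<in> carrier AM"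
  shows "f \<otimes>\<^bsub>AM\<^esub> g \<in> carrier AM"
proof -
  let ?S = "{x. f x \<noteq> \<zero>\<^bsub>A\<^esub>}" and ?T = "{x. g x \<noteq> \<zero>\<^bsub>A\<^esub>}"
  note S = AM_support[OF f] and T = AM_support[OF g]
  have mult: "(f \<otimes>\<^bsub>AM\<^esub> g) z =
      (\<Oplus>\<^bsub>A\<^esub>p\<in>{p \<in> ?S \<times> ?T. fst p \<otimes>\<^bsub>M\<^esub> snd p = z}. f (fst p) \<otimes>\<^bsub>A\<^esub> g (snd p))" for z
    by (rule AM_mult) (use f g S T in auto)
  have zero: "(f \<otimes>\<^bsub>AM\<^esub> g) z = \<zero>\<^bsub>A\<^esub>" if "z \<notin> (\<lambda>(x, y). x \<otimes>\<^bsub>M\<^esub> y) ` (?S \<times> ?T)" for z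
  proof -
    have "{p \<in> ?S \<times> ?T. fst p \<otimes>\<^bsub>M\<^esub> snd p = z} = {}" using that by auto
    then show ?thesis unfolding mult by (simp only: A.finsum_empty)
  qed
  then have "{z. (f \<otimes>\<^bsub>AM\<^esub> g) z \<noteq> \<zero>\<^bsub>A\<^esub>} \<subseteq> (\<lambda>(x, y). x \<otimes>\<^bsub>M\<^esub> y) ` (?S \<times> ?T)" by blast
  moreover have "(\<lambda>(x, y). x \<otimes>\<^bsub>M\<^esub> y) ` (?S \<times> ?T) \<subseteq> carrier M" using S(2) T(2) by auto
  moreover have "(f \<otimes>\<^bsub>AM\<^esub> g) z \<in> carrier A" for z
    unfolding mult using f g by (intro A.finsum_closed) auto
  ultimately show ?thesis
    unfolding mem_carrier_AM using S(1) T(1) zero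
    by (meson finite_SigmaI finite_imageI finite_subset subsetD)
qed

text \<open>Identities between expressions that are linear in \<open>f\<close> need to be checked on basis elements only.
With this, associativity and the multiplicativity of linear extensions reduce to identities in the
monoid.\<close>

lemma AM_induct [consumes 1, case_names zero add]:
  assumes "f \<in> carrier AM"
    and zero: "P \<zero>\<^bsub>AM\<^esub>"
    and add: "\<And>f a x. f \<in> carrier AM \<Longrightarrow> P f \<Longrightarrow> a \<in> carrier A \<Longrightarrow> x \<in> carrier M
      \<Longrightarrow> P (f \<oplus>\<^bsub>AM\<^esub> a \<odot>\<^bsub>AM\<^esub> e x)"
  shows "P f"
proof -
  have "P f" if "finite S" "{x. f x \<noteq> \<zero>\<^bsub>A\<^esub>} = S" "f \<in> carrier AM" for S f
    using that
  proof (induction S arbitrary: f)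
    case empty
    then have "f = \<zero>\<^bsub>AM\<^esub>" by (auto simp: AM_zero)
    then show ?case using zero by simp
  next
    case (insert x S)
    define g where "g = f(x := \<zero>\<^bsub>A\<^esub>)"
    have supp_g: "{y. g y \<noteq> \<zero>\<^bsub>A\<^esub>} = S" using insert by (auto simp: g_def)
    then have g: "g \<in> carrier AM"
      using insert by (auto simp: mem_carrier_AM g_def)
    have x: "x \<in> carrier M" using insert.prems by (auto simp: mem_carrier_AM)
    have "f = g \<oplus>\<^bsub>AM\<^esub> f x \<odot>\<^bsub>AM\<^esub> e x"
      using insert.prems(2) by (auto simp: AM_add AM_smult basis_elt_def g_def)
    then show ?case
      using add[OF g insert.IH[OF supp_g g], of "f x" x] x insert.prems(2) by simp
  qed
  then show ?thesis using assms(1) AM_support by blast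
qed

lemma basis_mult:
  assumes "x \<in> carrier M" "y \<in> carrier M"
  shows "e x \<otimes>\<^bsub>AM\<^esub> e y = e (x \<otimes>\<^bsub>M\<^esub> y)"
proof
  fix z
  have "(e x \<otimes>\<^bsub>AM\<^esub> e y) z =
      (\<Oplus>\<^bsub>A\<^esub>p\<in>{p \<in> {x} \<times> {y}. fst p \<otimes>\<^bsub>M\<^esub> snd p = z}. e x (fst p) \<otimes>\<^bsub>A\<^esub> e y (snd p))"
  proof (rule AM_mult)
    show "{z. e x z \<noteq> \<zero>\<^bsub>A\<^esub>} \<subseteq> {x}" "{z. e y z \<noteq> \<zero>\<^bsub>A\<^esub>} \<subseteq> {y}"
      by (auto simp: basis_elt_def)
  qed (use assms in auto)
  also have "{p \<in> {x} \<times> {y}. fst p \<otimes>\<^bsub>M\<^esub> snd p = z} = (if z = x \<otimes>\<^bsub>M\<^esub> y then {(x, y)} else {})"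
    by auto
  also have "(\<Oplus>\<^bsub>A\<^esub>p\<in>\<dots>. e x (fst p) \<otimes>\<^bsub>A\<^esub> e y (snd p)) = e (x \<otimes>\<^bsub>M\<^esub> y) z"
    by (simp add: basis_elt_def)
  finally show "(e x \<otimes>\<^bsub>AM\<^esub> e y) z = e (x \<otimes>\<^bsub>M\<^esub> y) z" .
qed

lemma AM_mult_comm:
  assumes f: "f \<in> carrier AM" and g: "g \<in> carrier AM"
  shows "f \<otimes>\<^bsub>AM\<^esub> g = g \<otimes>\<^bsub>AM\<^esub> f"
proof
  fix z
  let ?S = "{x. f x \<noteq> \<zero>\<^bsub>A\<^esub>}" and ?T = "{x. g x \<noteq> \<zero>\<^bsub>A\<^esub>}"
  note S = AM_support[OF f] and T = AM_support[OF g]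
  let ?P = "{p \<in> ?S \<times> ?T. fst p \<otimes>\<^bsub>M\<^esub> snd p = z}"
  have "(g \<otimes>\<^bsub>AM\<^esub> f) z = (\<Oplus>\<^bsub>A\<^esub>p\<in>{p \<in> ?T \<times> ?S. fst p \<otimes>\<^bsub>M\<^esub> snd p = z}. g (fst p) \<otimes>\<^bsub>A\<^esub> f (snd p))"
    by (rule AM_mult) (use f g S T in auto)
  also have "{p \<in> ?T \<times> ?S. fst p \<otimes>\<^bsub>M\<^esub> snd p = z} = prod.swap ` ?P"
  proof -
    have "y \<otimes>\<^bsub>M\<^esub> x = x \<otimes>\<^bsub>M\<^esub> y" if "x \<in> ?S" "y \<in> ?T" for x y
      using that S(2) T(2) by (intro M.m_comm) blast+
    then show ?thesis by force
  qed
  also have "(\<Oplus>\<^bsub>A\<^esub>p\<in>prod.swap ` ?P. g (fst p) \<otimes>\<^bsub>A\<^esub> f (snd p)) =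
      (\<Oplus>\<^bsub>A\<^esub>p\<in>?P. g (fst (prod.swap p)) \<otimes>\<^bsub>A\<^esub> f (snd (prod.swap p)))"
    by (rule A.finsum_reindex) (use f g in auto)
  also have "\<dots> = (\<Oplus>\<^bsub>A\<^esub>p\<in>?P. f (fst p) \<otimes>\<^bsub>A\<^esub> g (snd p))"
    by (rule A.finsum_cong') (use f g in \<open>auto intro: A.m_comm\<close>)
  also have "\<dots> = (f \<otimes>\<^bsub>AM\<^esub> g) z"
    by (rule AM_mult[symmetric]) (use f g S T in auto)
  finally show "(f \<otimes>\<^bsub>AM\<^esub> g) z = (g \<otimes>\<^bsub>AM\<^esub> f) z" by (rule sym)
qed

lemma AM_l_distr:
  assumes "f \<in> carrier AM" "g \<in> carrier AM" "h \<in> carrier AM"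
  shows "(f \<oplus>\<^bsub>AM\<^esub> g) \<otimes>\<^bsub>AM\<^esub> h = f \<otimes>\<^bsub>AM\<^esub> h \<oplus>\<^bsub>AM\<^esub> g \<otimes>\<^bsub>AM\<^esub> h"
proof
  fix z
  let ?S = "{x. f x \<noteq> \<zero>\<^bsub>A\<^esub>} \<union> {x. g x \<noteq> \<zero>\<^bsub>A\<^esub>}" and ?T = "{x. h x \<noteq> \<zero>\<^bsub>A\<^esub>}"
  let ?P = "{p \<in> ?S \<times> ?T. fst p \<otimes>\<^bsub>M\<^esub> snd p = z}"
  note fin = assms[THEN AM_support(1)]
  have "((f \<oplus>\<^bsub>AM\<^esub> g) \<otimes>\<^bsub>AM\<^esub> h) z = (\<Oplus>\<^bsub>A\<^esub>p\<in>?P. (f \<oplus>\<^bsub>AM\<^esub> g) (fst p) \<otimes>\<^bsub>A\<^esub> h (snd p))"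
    by (rule AM_mult) (use assms fin in \<open>auto simp: AM_apply\<close>)
  also have "\<dots> = (\<Oplus>\<^bsub>A\<^esub>p\<in>?P. f (fst p) \<otimes>\<^bsub>A\<^esub> h (snd p) \<oplus>\<^bsub>A\<^esub> g (fst p) \<otimes>\<^bsub>A\<^esub> h (snd p))"
    by (rule A.finsum_cong') (use assms in \<open>auto simp: AM_apply A.l_distr\<close>)
  also have "\<dots> = (\<Oplus>\<^bsub>A\<^esub>p\<in>?P. f (fst p) \<otimes>\<^bsub>A\<^esub> h (snd p)) \<oplus>\<^bsub>A\<^esub> (\<Oplus>\<^bsub>A\<^esub>p\<in>?P. g (fst p) \<otimes>\<^bsub>A\<^esub> h (snd p))"
    by (rule A.finsum_addf) (use assms in auto)
  also have "(\<Oplus>\<^bsub>A\<^esub>p\<in>?P. f (fst p) \<otimes>\<^bsub>A\<^esub> h (snd p)) = (f \<otimes>\<^bsub>AM\<^esub> h) z"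
    by (rule AM_mult[symmetric]) (use assms fin in auto)
  also have "(\<Oplus>\<^bsub>A\<^esub>p\<in>?P. g (fst p) \<otimes>\<^bsub>A\<^esub> h (snd p)) = (g \<otimes>\<^bsub>AM\<^esub> h) z"
    by (rule AM_mult[symmetric]) (use assms fin in auto)
  finally show "((f \<oplus>\<^bsub>AM\<^esub> g) \<otimes>\<^bsub>AM\<^esub> h) z = (f \<otimes>\<^bsub>AM\<^esub> h \<oplus>\<^bsub>AM\<^esub> g \<otimes>\<^bsub>AM\<^esub> h) z"
    by (simp add: AM_add)
qed

lemma AM_smult_assoc2:
  assumes "a \<in> carrier A" "f \<in> carrier AM" "g \<in> carrier AM"
  shows "(a \<odot>\<^bsub>AM\<^esub> f) \<otimes>\<^bsub>AM\<^esub> g = a \<odot>\<^bsub>AM\<^esub> (f \<otimes>\<^bsub>AM\<^esub> g)"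
proof
  fix z
  let ?S = "{x. f x \<noteq> \<zero>\<^bsub>A\<^esub>}" and ?T = "{x. g x \<noteq> \<zero>\<^bsub>A\<^esub>}"
  let ?P = "{p \<in> ?S \<times> ?T. fst p \<otimes>\<^bsub>M\<^esub> snd p = z}"
  note fin = assms(2,3)[THEN AM_support(1)]
  have "((a \<odot>\<^bsub>AM\<^esub> f) \<otimes>\<^bsub>AM\<^esub> g) z = (\<Oplus>\<^bsub>A\<^esub>p\<in>?P. (a \<odot>\<^bsub>AM\<^esub> f) (fst p) \<otimes>\<^bsub>A\<^esub> g (snd p))"
    by (rule AM_mult) (use assms fin in \<open>auto simp: AM_apply\<close>)
  also have "\<dots> = (\<Oplus>\<^bsub>A\<^esub>p\<in>?P. a \<otimes>\<^bsub>A\<^esub> (f (fst p) \<otimes>\<^bsub>A\<^esub> g (snd p)))"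
    by (rule A.finsum_cong') (use assms in \<open>auto simp: AM_apply A.m_assoc\<close>)
  also have "\<dots> = a \<otimes>\<^bsub>A\<^esub> (\<Oplus>\<^bsub>A\<^esub>p\<in>?P. f (fst p) \<otimes>\<^bsub>A\<^esub> g (snd p))"
    by (rule A.finsum_rdistr[symmetric]) (use assms fin in auto)
  also have "(\<Oplus>\<^bsub>A\<^esub>p\<in>?P. f (fst p) \<otimes>\<^bsub>A\<^esub> g (snd p)) = (f \<otimes>\<^bsub>AM\<^esub> g) z"
    by (rule AM_mult[symmetric]) (use assms fin in auto)
  finally show "((a \<odot>\<^bsub>AM\<^esub> f) \<otimes>\<^bsub>AM\<^esub> g) z = (a \<odot>\<^bsub>AM\<^esub> (f \<otimes>\<^bsub>AM\<^esub> g)) z"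
    by (simp add: AM_smult)
qed

lemma AM_zero_mult:
  assumes "f \<in> carrier AM"
  shows "\<zero>\<^bsub>AM\<^esub> \<otimes>\<^bsub>AM\<^esub> f = \<zero>\<^bsub>AM\<^esub>"
proof -
  have zero: "\<zero>\<^bsub>AM\<^esub> = \<zero>\<^bsub>A\<^esub> \<odot>\<^bsub>AM\<^esub> g" if "g \<in> carrier AM" for g
    using that by (auto simp: AM_zero AM_smult)
  have "\<zero>\<^bsub>AM\<^esub> \<otimes>\<^bsub>AM\<^esub> f = (\<zero>\<^bsub>A\<^esub> \<odot>\<^bsub>AM\<^esub> f) \<otimes>\<^bsub>AM\<^esub> f" using zero[OF assms] by simp
  also have "\<dots> = \<zero>\<^bsub>A\<^esub> \<odot>\<^bsub>AM\<^esub> (f \<otimes>\<^bsub>AM\<^esub> f)" using assms by (simp add: AM_smult_assoc2)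
  also have "\<dots> = \<zero>\<^bsub>AM\<^esub>" using zero[of "f \<otimes>\<^bsub>AM\<^esub> f"] assms by simp
  finally show ?thesis .
qed

lemma AM_mult_assoc:
  assumes "f \<in> carrier AM" "g \<in> carrier AM" "h \<in> carrier AM"
  shows "f \<otimes>\<^bsub>AM\<^esub> g \<otimes>\<^bsub>AM\<^esub> h = f \<otimes>\<^bsub>AM\<^esub> (g \<otimes>\<^bsub>AM\<^esub> h)"
proof -
  have mult_add: "f \<otimes>\<^bsub>AM\<^esub> (g \<oplus>\<^bsub>AM\<^esub> a \<odot>\<^bsub>AM\<^esub> g') = f \<otimes>\<^bsub>AM\<^esub> g \<oplus>\<^bsub>AM\<^esub> a \<odot>\<^bsub>AM\<^esub> (f \<otimes>\<^bsub>AM\<^esub> g')"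
    if "f \<in> carrier AM" "g \<in> carrier AM" "g' \<in> carrier AM" "a \<in> carrier A" for f g g' a
    using that by (simp add: AM_mult_comm[of f] AM_l_distr AM_smult_assoc2)
  have mult_zero: "f \<otimes>\<^bsub>AM\<^esub> \<zero>\<^bsub>AM\<^esub> = \<zero>\<^bsub>AM\<^esub>" if "f \<in> carrier AM" for f
    using that by (simp add: AM_mult_comm[of f] AM_zero_closed AM_zero_mult)
  have basis: "e x \<otimes>\<^bsub>AM\<^esub> e y \<otimes>\<^bsub>AM\<^esub> h = e x \<otimes>\<^bsub>AM\<^esub> (e y \<otimes>\<^bsub>AM\<^esub> h)"
    if "x \<in> carrier M" "y \<in> carrier M" for x y
    using assms(3)
    by (induction h rule: AM_induct)
       (use that in \<open>simp_all add: mult_add mult_zero basis_mult M.m_assoc\<close>)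
  have basis2: "e x \<otimes>\<^bsub>AM\<^esub> g \<otimes>\<^bsub>AM\<^esub> h = e x \<otimes>\<^bsub>AM\<^esub> (g \<otimes>\<^bsub>AM\<^esub> h)" if "x \<in> carrier M" for x
    using assms(2)
    by (induction g rule: AM_induct)
       (use that assms in \<open>simp_all add: mult_add mult_zero AM_zero_mult AM_l_distr AM_smult_assoc2 basis\<close>)
  show ?thesis
    using assms(1)
    by (induction f rule: AM_induct)
       (use assms in \<open>simp_all add: AM_zero_mult AM_l_distr AM_smult_assoc2 basis2\<close>)
qed

lemma AM_cring: "cring AM"
proof (rule cringI)
  show "abelian_group AM"
  proof (rule abelian_groupI)
    fix f assume f: "f \<in> carrier AM"
    have "{x. \<ominus>\<^bsub>A\<^esub> f x \<noteq> \<zero>\<^bsub>A\<^esub>} \<subseteq> {x. f x \<noteq> \<zero>\<^bsub>A\<^esub>}" by auto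
    with f have "(\<lambda>x. \<ominus>\<^bsub>A\<^esub> f x) \<in> carrier AM"
      by (auto simp: mem_carrier_AM intro: finite_subset)
    then show "\<exists>g\<in>carrier AM. g \<oplus>\<^bsub>AM\<^esub> f = \<zero>\<^bsub>AM\<^esub>"
      using f by (intro bexI[of _ "\<lambda>x. \<ominus>\<^bsub>A\<^esub> f x"]) (auto simp: AM_add AM_zero A.l_neg)
  qed (simp_all add: AM_zero_closed, auto simp: AM_add AM_zero A.a_ac)
  show "comm_monoid AM"
  proof (rule comm_monoidI)
    fix f assume "f \<in> carrier AM"
    then show "\<one>\<^bsub>AM\<^esub> \<otimes>\<^bsub>AM\<^esub> f = f"
    proof (induction f rule: AM_induct)
      case zero
      then show ?case by (simp add: AM_one AM_mult_comm[of "e _"] AM_zero_closed AM_zero_mult)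
    next
      case (add f a x)
      then have "\<one>\<^bsub>AM\<^esub> \<otimes>\<^bsub>AM\<^esub> (f \<oplus>\<^bsub>AM\<^esub> a \<odot>\<^bsub>AM\<^esub> e x) = \<one>\<^bsub>AM\<^esub> \<otimes>\<^bsub>AM\<^esub> f \<oplus>\<^bsub>AM\<^esub> a \<odot>\<^bsub>AM\<^esub> (e x \<otimes>\<^bsub>AM\<^esub> \<one>\<^bsub>AM\<^esub>)"
        by (simp add: AM_one AM_mult_comm[of "e \<one>\<^bsub>M\<^esub>"] AM_l_distr AM_smult_assoc2)
      then show ?case using add by (simp add: AM_one basis_mult)
    qed
  qed (simp_all add: AM_one AM_mult_assoc, rule AM_mult_comm)
qed (simp add: AM_l_distr)

lemma AM_algebra: "algebra A AM"
  by (rule algebraI[OF A_cring AM_cring])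
     (simp_all add: AM_smult_assoc2, auto simp: AM_add AM_smult A.l_distr A.r_distr A.m_assoc)

end

text \<open>The universal property of the monoid algebra: a monoid homomorphism into the multiplicative monoid
of an \<open>A\<close>-algebra extends to an algebra homomorphism.\<close>

locale monoid_algebra_to_algebra = monoid_algebra_over A M
  for A :: "('a, 'm) ring_scheme" and M :: "('g, 'k) monoid_scheme" +
  fixes R :: "('a, 'b, 'l) module_scheme" and \<phi> :: "'g \<Rightarrow> 'b"
  assumes R_alg: "algebra A R"
    and \<phi>_closed [simp]: "\<And>x. x \<in> carrier M \<Longrightarrow> \<phi> x \<in> carrier R"
    and \<phi>_mult: "\<And>x y. x \<in> carrier M \<Longrightarrow> y \<in> carrier M \<Longrightarrow> \<phi> (x \<otimes>\<^bsub>M\<^esub> y) = \<phi> x \<otimes>\<^bsub>R\<^esub> \<phi> y"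
    and \<phi>_one: "\<phi> \<one>\<^bsub>M\<^esub> = \<one>\<^bsub>R\<^esub>"
begin

sublocale R: cring R by (rule algebra.M_cring[OF R_alg])
sublocale R_alg: algebra A R by (rule R_alg)
sublocale AM: cring AM by (rule AM_cring)
sublocale AM_alg: algebra A AM by (rule AM_algebra)

abbreviation lin where "lin \<equiv> linear_extension A R \<phi>"

lemma lin_eq:
  assumes "f \<in> carrier AM" "finite S" "{x. f x \<noteq> \<zero>\<^bsub>A\<^esub>} \<subseteq> S" "S \<subseteq> carrier M"
  shows "lin f = (\<Oplus>\<^bsub>R\<^esub>x\<in>S. f x \<odot>\<^bsub>R\<^esub> \<phi> x)"
  unfolding linear_extension_def
  by (rule R.add.finprod_mono_neutral_cong_left)
     (use assms in \<open>auto intro!: R_alg.smult_closed simp: subset_iff\<close>)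

lemma lin_closed [simp]: "f \<in> carrier AM \<Longrightarrow> lin f \<in> carrier R"
  unfolding linear_extension_def using AM_support[of f]
  by (intro R.finsum_closed) (auto intro!: R_alg.smult_closed)

lemma lin_add:
  assumes "f \<in> carrier AM" "g \<in> carrier AM"
  shows "lin (f \<oplus>\<^bsub>AM\<^esub> g) = lin f \<oplus>\<^bsub>R\<^esub> lin g"
proof -
  let ?S = "{x. f x \<noteq> \<zero>\<^bsub>A\<^esub>} \<union> {x. g x \<noteq> \<zero>\<^bsub>A\<^esub>}"
  have S: "finite ?S" "?S \<subseteq> carrier M" using assms AM_support by blast+
  have "lin (f \<oplus>\<^bsub>AM\<^esub> g) = (\<Oplus>\<^bsub>R\<^esub>x\<in>?S. (f \<oplus>\<^bsub>AM\<^esub> g) x \<odot>\<^bsub>R\<^esub> \<phi> x)"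
    by (rule lin_eq[OF _ S(1) _ S(2)]) (use assms in \<open>auto simp: AM_apply\<close>)
  also have "\<dots> = (\<Oplus>\<^bsub>R\<^esub>x\<in>?S. f x \<odot>\<^bsub>R\<^esub> \<phi> x \<oplus>\<^bsub>R\<^esub> g x \<odot>\<^bsub>R\<^esub> \<phi> x)"
    by (rule R.finsum_cong') (use assms S in \<open>auto simp: AM_apply R_alg.smult_l_distr\<close>)
  also have "\<dots> = (\<Oplus>\<^bsub>R\<^esub>x\<in>?S. f x \<odot>\<^bsub>R\<^esub> \<phi> x) \<oplus>\<^bsub>R\<^esub> (\<Oplus>\<^bsub>R\<^esub>x\<in>?S. g x \<odot>\<^bsub>R\<^esub> \<phi> x)"
    by (rule R.finsum_addf) (use assms S in auto)
  also have "\<dots> = lin f \<oplus>\<^bsub>R\<^esub> lin g"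
    using assms S by (simp add: lin_eq[of _ ?S])
  finally show ?thesis .
qed

lemma lin_smult:
  assumes "a \<in> carrier A" "f \<in> carrier AM"
  shows "lin (a \<odot>\<^bsub>AM\<^esub> f) = a \<odot>\<^bsub>R\<^esub> lin f"
proof -
  let ?S = "{x. f x \<noteq> \<zero>\<^bsub>A\<^esub>}"
  have S: "finite ?S" "?S \<subseteq> carrier M" using assms AM_support by blast+
  have "lin (a \<odot>\<^bsub>AM\<^esub> f) = (\<Oplus>\<^bsub>R\<^esub>x\<in>?S. (a \<odot>\<^bsub>AM\<^esub> f) x \<odot>\<^bsub>R\<^esub> \<phi> x)"
    by (rule lin_eq[OF _ S(1) _ S(2)]) (use assms in \<open>auto simp: AM_apply\<close>)
  also have "\<dots> = (\<Oplus>\<^bsub>R\<^esub>x\<in>?S. a \<odot>\<^bsub>R\<^esub> (f x \<odot>\<^bsub>R\<^esub> \<phi> x))"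
    by (rule R.finsum_cong') (use assms S in \<open>auto simp: AM_apply R_alg.smult_assoc1\<close>)
  also have "\<dots> = a \<odot>\<^bsub>R\<^esub> lin f"
    unfolding linear_extension_def
    by (rule R_alg.finsum_smult_ldistr[symmetric]) (use assms S in auto)
  finally show ?thesis .
qed

lemma lin_basis [simp]:
  assumes "x \<in> carrier M"
  shows "lin (e x) = \<phi> x"
proof -
  have "lin (e x) = (\<Oplus>\<^bsub>R\<^esub>y\<in>{x}. e x y \<odot>\<^bsub>R\<^esub> \<phi> y)"
  proof (rule lin_eq)
    show "{z. e x z \<noteq> \<zero>\<^bsub>A\<^esub>} \<subseteq> {x}" by (auto simp: basis_elt_def)
  qed (use assms in auto)
  also have "\<dots> = \<phi> x" using assms by (simp add: basis_elt_def)
  finally show ?thesis .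
qed

lemma lin_zero: "lin \<zero>\<^bsub>AM\<^esub> = \<zero>\<^bsub>R\<^esub>"
  by (simp add: linear_extension_def AM_zero)

lemma lin_mult_basis:
  assumes "f \<in> carrier AM" "x \<in> carrier M"
  shows "lin (e x \<otimes>\<^bsub>AM\<^esub> f) = \<phi> x \<otimes>\<^bsub>R\<^esub> lin f"
  using assms(1)
proof (induction f rule: AM_induct)
  case zero
  then show ?case using assms by (simp add: lin_zero)
next
  case (add f a y)
  have "e x \<otimes>\<^bsub>AM\<^esub> (a \<odot>\<^bsub>AM\<^esub> e y) = a \<odot>\<^bsub>AM\<^esub> e (x \<otimes>\<^bsub>M\<^esub> y)"
    using add assms by (simp add: AM.m_comm[of "e x"] AM_smult_assoc2 basis_mult M.m_comm)
  moreover have "\<phi> x \<otimes>\<^bsub>R\<^esub> (a \<odot>\<^bsub>R\<^esub> \<phi> y) = a \<odot>\<^bsub>R\<^esub> (\<phi> x \<otimes>\<^bsub>R\<^esub> \<phi> y)"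
    using add assms by (simp add: R.m_comm[of "\<phi> x"] R_alg.smult_assoc2)
  ultimately show ?case
    using add assms by (simp add: AM.r_distr R.r_distr lin_add lin_smult \<phi>_mult)
qed

lemma lin_mult:
  assumes "f \<in> carrier AM" "g \<in> carrier AM"
  shows "lin (f \<otimes>\<^bsub>AM\<^esub> g) = lin f \<otimes>\<^bsub>R\<^esub> lin g"
  using assms(1)
  by (induction f rule: AM_induct)
     (use assms(2) in \<open>simp_all add: lin_zero AM.l_distr R.l_distr lin_add lin_smult
        AM_smult_assoc2 R_alg.smult_assoc2 lin_mult_basis\<close>)

lemma lin_alg_hom: "lin \<in> alg_hom A AM R"
  by (rule alg_homI) (simp_all add: lin_mult lin_add lin_smult AM_one \<phi>_one)

end

section \<open>Tensor powers\<close>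

locale tensor_power_of =
  fixes A :: "('a, 'm) ring_scheme" and K :: "('a, 'b, 'k) module_scheme" and n :: nat
  assumes alg: "algebra A K"
begin

sublocale A: cring A by (rule algebra.R_cring[OF alg])
sublocale K: cring K by (rule algebra.M_cring[OF alg])
sublocale K_alg: algebra A K by (rule alg)

abbreviation tuples where "tuples \<equiv> product_group {..<n} (\<lambda>_. K)"

lemma tuples_comm_monoid: "comm_monoid tuples"
proof (rule comm_monoidI)
  fix x y assume "x \<in> carrier tuples" "y \<in> carrier tuples"
  then show "x \<otimes>\<^bsub>tuples\<^esub> y = y \<otimes>\<^bsub>tuples\<^esub> x"
    by (auto simp: PiE_iff fun_eq_iff intro: K.m_comm)
qed (auto simp: PiE_iff K.m_assoc extensional_def fun_eq_iff)

sublocale F: monoid_algebra_over A tuples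
  by (rule monoid_algebra_over.intro[OF A.cring_axioms tuples_comm_monoid])
sublocale F: cring F.AM by (rule F.AM_cring)
sublocale F_alg: algebra A F.AM by (rule F.AM_algebra)

abbreviation T where "T \<equiv> tensor_power A n K"
abbreviation rels where "rels \<equiv> multilinear_ideal A n K"
abbreviation cls where "cls f \<equiv> rels +>\<^bsub>F.AM\<^esub> f"
abbreviation pure where "pure \<equiv> pure_tensor A n K"

lemma tuple_update [simp]:
  "x \<in> {..<n} \<rightarrow>\<^sub>E carrier K \<Longrightarrow> i < n \<Longrightarrow> b \<in> carrier K \<Longrightarrow> x(i := b) \<in> {..<n} \<rightarrow>\<^sub>E carrier K"
  by (auto simp: PiE_iff extensional_def)

lemma relations_carrier:
  "additivity_relations A n K \<union> homogeneity_relations A n K \<subseteq> carrier F.AM"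
proof -
  have [simp]: "F.e x \<in> carrier F.AM" if "x \<in> {..<n} \<rightarrow>\<^sub>E carrier K" for x
    using that by (intro F.basis_closed) simp
  show ?thesis
    unfolding additivity_relations_def homogeneity_relations_def tuple_algebra_def
    by (rule Un_least; clarify; intro F.minus_closed F.AM_add_closed F.AM_smult_closed; simp)
qed

sublocale rels: ideal rels F.AM
  unfolding multilinear_ideal_def tuple_algebra_def
  by (rule F.genideal_ideal[OF relations_carrier])

lemma relations_in_ideal:
  "additivity_relations A n K \<union> homogeneity_relations A n K \<subseteq> rels"
  unfolding multilinear_ideal_def tuple_algebra_def
  using F.genideal_self[OF relations_carrier] by simp

lemma T_sel:
  "carrier T = carrier (F.AM Quot rels)" "\<zero>\<^bsub>T\<^esub> = \<zero>\<^bsub>F.AM Quot rels\<^esub>" "\<one>\<^bsub>T\<^esub> = \<one>\<^bsub>F.AM Quot rels\<^esub>"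
  "x \<oplus>\<^bsub>T\<^esub> y = x \<oplus>\<^bsub>F.AM Quot rels\<^esub> y" "x \<otimes>\<^bsub>T\<^esub> y = x \<otimes>\<^bsub>F.AM Quot rels\<^esub> y"
  "a \<odot>\<^bsub>T\<^esub> x = (\<Union>f\<in>x. cls (a \<odot>\<^bsub>F.AM\<^esub> f))"
  unfolding tensor_power_def tuple_algebra_def ring.extend_def module.fields_def
  by (simp_all only: partial_object.simps monoid.simps ring.simps module.simps)

lemma cls_ring_hom: "cls \<in> ring_hom F.AM (F.AM Quot rels)"
  by (rule rels.rcos_ring_hom)

lemma T_carrier: "carrier T = cls ` carrier F.AM"
  unfolding T_sel by (auto simp: FactRing_def A_RCOSETS_def')

lemma cls_closed [simp, intro]: "f \<in> carrier F.AM \<Longrightarrow> cls f \<in> carrier T"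
  by (auto simp: T_carrier)

lemma cls_add: "f \<in> carrier F.AM \<Longrightarrow> g \<in> carrier F.AM \<Longrightarrow> cls (f \<oplus>\<^bsub>F.AM\<^esub> g) = cls f \<oplus>\<^bsub>T\<^esub> cls g"
  unfolding T_sel by (rule ring_hom_add[OF cls_ring_hom])

lemma cls_mult: "f \<in> carrier F.AM \<Longrightarrow> g \<in> carrier F.AM \<Longrightarrow> cls (f \<otimes>\<^bsub>F.AM\<^esub> g) = cls f \<otimes>\<^bsub>T\<^esub> cls g"
  unfolding T_sel by (rule ring_hom_mult[OF cls_ring_hom])

lemma cls_one: "cls \<one>\<^bsub>F.AM\<^esub> = \<one>\<^bsub>T\<^esub>"
  unfolding T_sel by (rule ring_hom_one[OF cls_ring_hom])

lemma T_cring: "cring T"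
proof -
  interpret Q: cring "F.AM Quot rels" by (rule rels.quotient_is_cring[OF F.AM_cring])
  show ?thesis
  proof (rule cringI)
    show "abelian_group T"
    proof (rule abelian_groupI)
      fix X Y Z assume "X \<in> carrier T" "Y \<in> carrier T" "Z \<in> carrier T"
      then show "X \<oplus>\<^bsub>T\<^esub> Y \<oplus>\<^bsub>T\<^esub> Z = X \<oplus>\<^bsub>T\<^esub> (Y \<oplus>\<^bsub>T\<^esub> Z)"
        unfolding T_sel by (rule Q.a_assoc)
    next
      fix X Y assume "X \<in> carrier T" "Y \<in> carrier T"
      then show "X \<oplus>\<^bsub>T\<^esub> Y = Y \<oplus>\<^bsub>T\<^esub> X"
        unfolding T_sel by (rule Q.a_comm)
    next
      fix X assume "X \<in> carrier T"
      then show "\<exists>Y\<in>carrier T. Y \<oplus>\<^bsub>T\<^esub> X = \<zero>\<^bsub>T\<^esub>"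
        unfolding T_sel by (intro bexI[of _ "\<ominus>\<^bsub>F.AM Quot rels\<^esub> X"]) (simp_all add: Q.l_neg)
    qed (simp_all add: T_sel)
    show "comm_monoid T"
    proof (rule comm_monoidI)
      fix X Y Z assume "X \<in> carrier T" "Y \<in> carrier T" "Z \<in> carrier T"
      then show "X \<otimes>\<^bsub>T\<^esub> Y \<otimes>\<^bsub>T\<^esub> Z = X \<otimes>\<^bsub>T\<^esub> (Y \<otimes>\<^bsub>T\<^esub> Z)"
        unfolding T_sel by (rule Q.m_assoc)
    next
      fix X Y assume "X \<in> carrier T" "Y \<in> carrier T"
      then show "X \<otimes>\<^bsub>T\<^esub> Y = Y \<otimes>\<^bsub>T\<^esub> X"
        unfolding T_sel by (rule Q.m_comm)
    qed (simp_all add: T_sel)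
    fix X Y Z assume "X \<in> carrier T" "Y \<in> carrier T" "Z \<in> carrier T"
    then show "(X \<oplus>\<^bsub>T\<^esub> Y) \<otimes>\<^bsub>T\<^esub> Z = X \<otimes>\<^bsub>T\<^esub> Z \<oplus>\<^bsub>T\<^esub> Y \<otimes>\<^bsub>T\<^esub> Z"
      unfolding T_sel by (rule Q.l_distr)
  qed
qed

sublocale T: cring T by (rule T_cring)

lemma T_zero: "\<zero>\<^bsub>T\<^esub> = rels"
  by (simp add: T_sel FactRing_def)

lemma cls_zero: "cls \<zero>\<^bsub>F.AM\<^esub> = \<zero>\<^bsub>T\<^esub>"
  unfolding T_zero by (rule rels.a_rcos_const[OF rels.zero_closed])

lemma cls_eq_zero_iff: "f \<in> carrier F.AM \<Longrightarrow> cls f = \<zero>\<^bsub>T\<^esub> \<longleftrightarrow> f \<in> rels"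
  unfolding T_zero using rels.a_rcos_const rels.a_rcos_self by metis

lemma cls_repr: "f \<in> carrier F.AM \<Longrightarrow> g \<in> cls f \<Longrightarrow> g \<in> carrier F.AM \<and> cls g = cls f"
  using rels.a_repr_independence' rels.a_elemrcos_carrier by metis

lemma cls_smult:
  assumes "a \<in> carrier A" "f \<in> carrier F.AM"
  shows "cls (a \<odot>\<^bsub>F.AM\<^esub> f) = a \<odot>\<^bsub>T\<^esub> cls f"
proof -
  have smult: "cls (a \<odot>\<^bsub>F.AM\<^esub> g) = cls (a \<odot>\<^bsub>F.AM\<^esub> \<one>\<^bsub>F.AM\<^esub>) \<otimes>\<^bsub>T\<^esub> cls g" if "g \<in> carrier F.AM" for g
    using that assms by (subst cls_mult[symmetric]) (simp_all add: F_alg.smult_assoc2)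
  have "cls (a \<odot>\<^bsub>F.AM\<^esub> g) = cls (a \<odot>\<^bsub>F.AM\<^esub> f)" if "g \<in> cls f" for g
  proof -
    have "g \<in> carrier F.AM" and eq: "cls g = cls f" using cls_repr[OF assms(2) that] by auto
    then show ?thesis by (simp only: smult[OF \<open>g \<in> carrier F.AM\<close>] smult[OF assms(2)] eq)
  qed
  moreover have "f \<in> cls f" using assms rels.a_rcos_self by simp
  ultimately show ?thesis unfolding T_sel by blast
qed

lemma T_algebra: "algebra A T"
proof (rule algebraI[OF A.cring_axioms T_cring])
  fix a b X assume "a \<in> carrier A" "b \<in> carrier A" "X \<in> carrier T"
  then obtain f where [simp]: "a \<in> carrier A" "b \<in> carrier A" "f \<in> carrier F.AM" "X = cls f"
    by (auto simp: T_carrier)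
  show "(a \<oplus>\<^bsub>A\<^esub> b) \<odot>\<^bsub>T\<^esub> X = a \<odot>\<^bsub>T\<^esub> X \<oplus>\<^bsub>T\<^esub> b \<odot>\<^bsub>T\<^esub> X"
    by (simp add: F_alg.smult_l_distr flip: cls_smult cls_add)
  show "(a \<otimes>\<^bsub>A\<^esub> b) \<odot>\<^bsub>T\<^esub> X = a \<odot>\<^bsub>T\<^esub> (b \<odot>\<^bsub>T\<^esub> X)"
    by (simp add: F_alg.smult_assoc1 flip: cls_smult)
next
  fix a X assume "a \<in> carrier A" "X \<in> carrier T"
  then show "a \<odot>\<^bsub>T\<^esub> X \<in> carrier T" by (auto simp: T_carrier simp flip: cls_smult)
next
  fix X assume "X \<in> carrier T"
  then show "\<one>\<^bsub>A\<^esub> \<odot>\<^bsub>T\<^esub> X = X" by (auto simp: T_carrier simp flip: cls_smult)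
next
  fix a X Y assume "a \<in> carrier A" "X \<in> carrier T" "Y \<in> carrier T"
  then obtain f g where [simp]: "a \<in> carrier A" "f \<in> carrier F.AM" "X = cls f"
      "g \<in> carrier F.AM" "Y = cls g"
    by (auto simp: T_carrier)
  show "a \<odot>\<^bsub>T\<^esub> (X \<oplus>\<^bsub>T\<^esub> Y) = a \<odot>\<^bsub>T\<^esub> X \<oplus>\<^bsub>T\<^esub> a \<odot>\<^bsub>T\<^esub> Y"
    by (simp add: F_alg.smult_r_distr flip: cls_smult cls_add)
  show "(a \<odot>\<^bsub>T\<^esub> X) \<otimes>\<^bsub>T\<^esub> Y = a \<odot>\<^bsub>T\<^esub> (X \<otimes>\<^bsub>T\<^esub> Y)"
    by (simp add: F_alg.smult_assoc2 flip: cls_smult cls_mult)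
qed

sublocale T_alg: algebra A T by (rule T_algebra)

lemma pure_eq_cls: "x \<in> {..<n} \<rightarrow>\<^sub>E carrier K \<Longrightarrow> pure x = cls (F.e x)"
  by (simp add: pure_tensor_def tuple_algebra_def PiE_restrict)

lemma pure_restrict [simp]: "pure (restrict x {..<n}) = pure x"
  by (simp add: pure_tensor_def)

lemma pure_cong: "(\<And>i. i < n \<Longrightarrow> x i = y i) \<Longrightarrow> pure x = pure y"
  unfolding pure_tensor_def by (metis lessThan_iff restrict_ext)

lemma pure_closed [simp, intro]:
  assumes "\<And>i. i < n \<Longrightarrow> x i \<in> carrier K"
  shows "pure x \<in> carrier T"
proof -
  have "pure (restrict x {..<n}) \<in> carrier T"
    by (subst pure_eq_cls) (use assms in auto)
  then show ?thesis by simp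
qed

lemma pure_mult:
  assumes "\<And>i. i < n \<Longrightarrow> x i \<in> carrier K" "\<And>i. i < n \<Longrightarrow> y i \<in> carrier K"
  shows "pure x \<otimes>\<^bsub>T\<^esub> pure y = pure (\<lambda>i. x i \<otimes>\<^bsub>K\<^esub> y i)"
proof -
  let ?x = "restrict x {..<n}" and ?y = "restrict y {..<n}"
  have xy: "?x \<in> {..<n} \<rightarrow>\<^sub>E carrier K" "?y \<in> {..<n} \<rightarrow>\<^sub>E carrier K" using assms by auto
  then have "pure ?x \<otimes>\<^bsub>T\<^esub> pure ?y = cls (F.e (?x \<otimes>\<^bsub>tuples\<^esub> ?y))"
    by (simp add: pure_eq_cls F.basis_mult del: mult_product_group pure_restrict flip: cls_mult)
  also have "\<dots> = pure (?x \<otimes>\<^bsub>tuples\<^esub> ?y)"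
    by (rule pure_eq_cls[symmetric]) (use assms in auto)
  also have "\<dots> = pure (\<lambda>i. x i \<otimes>\<^bsub>K\<^esub> y i)"
    by (rule pure_cong) simp
  finally show ?thesis by simp
qed

lemma pure_one: "pure (\<lambda>_. \<one>\<^bsub>K\<^esub>) = \<one>\<^bsub>T\<^esub>"
  by (simp add: pure_tensor_def tuple_algebra_def cls_one[symmetric] F.AM_one)

text \<open>Tensors are sums of multiples of pure tensors; this is inherited from the basis elements of the
free algebra on tuples.\<close>

lemma T_induct [consumes 1, case_names zero add]:
  assumes "X \<in> carrier T"
    and zero: "P \<zero>\<^bsub>T\<^esub>"
    and add: "\<And>X a x. X \<in> carrier T \<Longrightarrow> P X \<Longrightarrow> a \<in> carrier A \<Longrightarrow> x \<in> {..<n} \<rightarrow>\<^sub>E carrier K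
      \<Longrightarrow> P (X \<oplus>\<^bsub>T\<^esub> a \<odot>\<^bsub>T\<^esub> pure x)"
  shows "P X"
proof -
  obtain f where f: "f \<in> carrier F.AM" "X = cls f" using assms(1) by (auto simp: T_carrier)
  from f(1) have "P (cls f)"
  proof (induction f rule: F.AM_induct)
    case zero
    then show ?case by (simp add: cls_zero assms(2))
  next
    case (add f a x)
    then show ?case
      using assms(3)[of "cls f" a x] by (simp add: cls_add cls_smult pure_eq_cls)
  qed
  then show ?thesis using f by simp
qed

lemma alg_hom_eqI:
  assumes g: "g \<in> alg_hom A T R" and h: "h \<in> alg_hom A T R" and R: "algebra A R"
    and eq: "\<And>x. x \<in> {..<n} \<rightarrow>\<^sub>E carrier K \<Longrightarrow> g (pure x) = h (pure x)"
    and X: "X \<in> carrier T"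
  shows "g X = h X"
proof -
  interpret g: ring_hom_cring T R g by (rule alg_hom_ring_hom_cring[OF g T_algebra R])
  interpret h: ring_hom_cring T R h by (rule alg_hom_ring_hom_cring[OF h T_algebra R])
  from X show ?thesis
  proof (induction X rule: T_induct)
    case zero
    then show ?case by simp
  next
    case (add X a x)
    have [simp]: "pure x \<in> carrier T" using add by (intro pure_closed) auto
    show ?case using add by (simp add: alg_homD(5)[OF g] alg_homD(5)[OF h] eq)
  qed
qed

lemma pure_add:
  assumes x: "\<And>j. j < n \<Longrightarrow> x j \<in> carrier K" and i: "i < n" "b \<in> carrier K" "c \<in> carrier K"
  shows "pure (x(i := b \<oplus>\<^bsub>K\<^esub> c)) = pure (x(i := b)) \<oplus>\<^bsub>T\<^esub> pure (x(i := c))"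
proof -
  let ?x = "restrict x {..<n}"
  let ?f = "F.e (?x(i := b \<oplus>\<^bsub>K\<^esub> c))" and ?g = "F.e (?x(i := b)) \<oplus>\<^bsub>F.AM\<^esub> F.e (?x(i := c))"
  have x': "?x \<in> {..<n} \<rightarrow>\<^sub>E carrier K" using x by auto
  have "?f \<ominus>\<^bsub>F.AM\<^esub> ?g \<in> rels"
    using relations_in_ideal i x' unfolding additivity_relations_def tuple_algebra_def by blast
  then have "cls ?f = cls ?g"
    by (subst (asm) F.quotient_eq_iff_same_a_r_cos[OF rels.ideal_axioms])
       (use i x' in \<open>simp_all add: F.basis_closed del: restrict_PiE_iff\<close>)
  then have "pure (?x(i := b \<oplus>\<^bsub>K\<^esub> c)) = pure (?x(i := b)) \<oplus>\<^bsub>T\<^esub> pure (?x(i := c))"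
    using i x' by (simp add: pure_eq_cls cls_add del: restrict_PiE_iff)
  moreover have "pure (?x(i := d)) = pure (x(i := d))" for d by (rule pure_cong) auto
  ultimately show ?thesis by simp
qed

lemma pure_smult:
  assumes x: "\<And>j. j < n \<Longrightarrow> x j \<in> carrier K" and i: "i < n" "a \<in> carrier A" "b \<in> carrier K"
  shows "pure (x(i := a \<odot>\<^bsub>K\<^esub> b)) = a \<odot>\<^bsub>T\<^esub> pure (x(i := b))"
proof -
  let ?x = "restrict x {..<n}"
  let ?f = "F.e (?x(i := a \<odot>\<^bsub>K\<^esub> b))" and ?g = "a \<odot>\<^bsub>F.AM\<^esub> F.e (?x(i := b))"
  have x': "?x \<in> {..<n} \<rightarrow>\<^sub>E carrier K" using x by auto
  have "?f \<ominus>\<^bsub>F.AM\<^esub> ?g \<in> rels"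
    using relations_in_ideal i x' unfolding homogeneity_relations_def tuple_algebra_def by blast
  then have "cls ?f = cls ?g"
    by (subst (asm) F.quotient_eq_iff_same_a_r_cos[OF rels.ideal_axioms])
       (use i x' in \<open>simp_all add: F.basis_closed del: restrict_PiE_iff\<close>)
  then have "pure (?x(i := a \<odot>\<^bsub>K\<^esub> b)) = a \<odot>\<^bsub>T\<^esub> pure (?x(i := b))"
    using i x' by (simp add: pure_eq_cls cls_smult del: restrict_PiE_iff)
  moreover have "pure (?x(i := d)) = pure (x(i := d))" for d by (rule pure_cong) auto
  ultimately show ?thesis by simp
qed

end

section \<open>Maps out of tensor powers\<close>

text \<open>The universal property of the tensor power as an algebra. Such a \<open>\<phi>\<close> is a monoid homomorphism on
tuples and therefore extends to the free algebra on tuples. The kernel of the extension is an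
ideal, so it contains the ideal of relations as soon as it contains its generators.\<close>

locale multiplicative_multilinear = tensor_power_of A K n
  for A :: "('a, 'm) ring_scheme" and K :: "('a, 'b, 'k) module_scheme" and n :: nat +
  fixes R :: "('a, 'c, 'l) module_scheme" and \<phi> :: "(nat \<Rightarrow> 'b) \<Rightarrow> 'c"
  assumes R_alg: "algebra A R"
    and \<phi>_closed: "\<And>x. x \<in> {..<n} \<rightarrow>\<^sub>E carrier K \<Longrightarrow> \<phi> x \<in> carrier R"
    and \<phi>_mult: "\<And>x y. x \<in> {..<n} \<rightarrow>\<^sub>E carrier K \<Longrightarrow> y \<in> {..<n} \<rightarrow>\<^sub>E carrier K
      \<Longrightarrow> \<phi> (\<lambda>i\<in>{..<n}. x i \<otimes>\<^bsub>K\<^esub> y i) = \<phi> x \<otimes>\<^bsub>R\<^esub> \<phi> y"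
    and \<phi>_one: "\<phi> (\<lambda>i\<in>{..<n}. \<one>\<^bsub>K\<^esub>) = \<one>\<^bsub>R\<^esub>"
    and \<phi>_add: "\<And>x i b c. x \<in> {..<n} \<rightarrow>\<^sub>E carrier K \<Longrightarrow> i < n \<Longrightarrow> b \<in> carrier K \<Longrightarrow> c \<in> carrier K
      \<Longrightarrow> \<phi> (x(i := b \<oplus>\<^bsub>K\<^esub> c)) = \<phi> (x(i := b)) \<oplus>\<^bsub>R\<^esub> \<phi> (x(i := c))"
    and \<phi>_smult: "\<And>x i a b. x \<in> {..<n} \<rightarrow>\<^sub>E carrier K \<Longrightarrow> i < n \<Longrightarrow> a \<in> carrier A \<Longrightarrow> b \<in> carrier K
      \<Longrightarrow> \<phi> (x(i := a \<odot>\<^bsub>K\<^esub> b)) = a \<odot>\<^bsub>R\<^esub> \<phi> (x(i := b))"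
begin

sublocale L: monoid_algebra_to_algebra A tuples R \<phi>
proof (intro monoid_algebra_to_algebra.intro monoid_algebra_to_algebra_axioms.intro)
  show "monoid_algebra_over A tuples" by (rule F.monoid_algebra_over_axioms)
  show "algebra A R" by (rule R_alg)
  show "\<phi> \<one>\<^bsub>tuples\<^esub> = \<one>\<^bsub>R\<^esub>" by (simp add: \<phi>_one)
  fix x y assume x: "x \<in> carrier tuples"
  then show "\<phi> x \<in> carrier R" by (simp add: \<phi>_closed)
  assume y: "y \<in> carrier tuples"
  show "\<phi> (x \<otimes>\<^bsub>tuples\<^esub> y) = \<phi> x \<otimes>\<^bsub>R\<^esub> \<phi> y"
    using \<phi>_mult x y by (simp only: carrier_product_group mult_product_group)
qed

sublocale lin: ring_hom_cring F.AM R L.lin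
  by (rule alg_hom_ring_hom_cring[OF L.lin_alg_hom F.AM_algebra R_alg])

lemma lin_rels:
  assumes "f \<in> rels"
  shows "L.lin f = \<zero>\<^bsub>R\<^esub>"
proof -
  have "additivity_relations A n K \<union> homogeneity_relations A n K \<subseteq> a_kernel F.AM R L.lin"
  proof
    fix f assume f: "f \<in> additivity_relations A n K \<union> homogeneity_relations A n K"
    have e: "F.e x \<in> carrier F.AM" "L.lin (F.e x) = \<phi> x" if "x \<in> {..<n} \<rightarrow>\<^sub>E carrier K" for x
      using that by (auto intro: F.basis_closed L.lin_basis)
    have minus: "L.lin (g \<ominus>\<^bsub>F.AM\<^esub> g') = \<zero>\<^bsub>R\<^esub>"
      if "g \<in> carrier F.AM" "g' \<in> carrier F.AM" "L.lin g = L.lin g'" for g g'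
      using that by (simp add: a_minus_def L.R.r_neg)
    from f consider (add) x i b c where "x \<in> {..<n} \<rightarrow>\<^sub>E carrier K" "i < n" "b \<in> carrier K" "c \<in> carrier K"
        "f = F.e (x(i := b \<oplus>\<^bsub>K\<^esub> c)) \<ominus>\<^bsub>F.AM\<^esub> (F.e (x(i := b)) \<oplus>\<^bsub>F.AM\<^esub> F.e (x(i := c)))"
      | (smult) x i a b where "x \<in> {..<n} \<rightarrow>\<^sub>E carrier K" "i < n" "a \<in> carrier A" "b \<in> carrier K"
        "f = F.e (x(i := a \<odot>\<^bsub>K\<^esub> b)) \<ominus>\<^bsub>F.AM\<^esub> (a \<odot>\<^bsub>F.AM\<^esub> F.e (x(i := b)))"
      unfolding additivity_relations_def homogeneity_relations_def tuple_algebra_def by blast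
    then have "L.lin f = \<zero>\<^bsub>R\<^esub>"
    proof cases
      case add
      then show ?thesis
        by (simp only: add(5), intro minus) (simp_all add: e L.lin_add \<phi>_add)
    next
      case smult
      then show ?thesis
        by (simp only: smult(5), intro minus) (simp_all add: e L.lin_smult \<phi>_smult)
    qed
    then show "f \<in> a_kernel F.AM R L.lin"
      using f relations_carrier unfolding a_kernel_def' by blast
  qed
  then have "rels \<subseteq> a_kernel F.AM R L.lin"
    unfolding multilinear_ideal_def tuple_algebra_def
    by (intro F.genideal_minimal lin.ring.kernel_is_ideal)
  with assms show ?thesis unfolding a_kernel_def' by blast
qed

text \<open>Any representative of a tensor may be used, because two of them differ by a relation. Taking an
arbitrary one works for every type of values, whereas the union in \<^const>\<open>tensor_power_map\<close>
only makes sense for sets as values.\<close>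

definition lift where "lift X = L.lin (SOME f. f \<in> X)"

lemma lift_eq:
  assumes X: "X \<in> carrier T" and f: "f \<in> X"
  shows "lift X = L.lin f"
proof -
  obtain g where g: "g \<in> carrier F.AM" "X = cls g" using X by (auto simp: T_carrier)
  have "L.lin f' = L.lin g" if f': "f' \<in> X" for f'
  proof -
    obtain i where "i \<in> rels" "f' = i \<oplus>\<^bsub>F.AM\<^esub> g"
      using f' g by (auto simp: a_r_coset_def')
    then show ?thesis using g rels.Icarr lin_rels by simp
  qed
  then show ?thesis unfolding lift_def using f by (metis someI)
qed

lemma lift_cls: "f \<in> carrier F.AM \<Longrightarrow> lift (cls f) = L.lin f"
  by (rule lift_eq) (auto intro: rels.a_rcos_self)

lemma lift_pure: "x \<in> {..<n} \<rightarrow>\<^sub>E carrier K \<Longrightarrow> lift (pure x) = \<phi> x"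
  by (simp add: pure_eq_cls lift_cls)

theorem lift_alg_hom: "lift \<in> alg_hom A T R"
proof (rule alg_homI)
  fix X Y assume "X \<in> carrier T" "Y \<in> carrier T"
  then obtain f g where "f \<in> carrier F.AM" "X = cls f" "g \<in> carrier F.AM" "Y = cls g"
    by (auto simp: T_carrier)
  then show "lift (X \<otimes>\<^bsub>T\<^esub> Y) = lift X \<otimes>\<^bsub>R\<^esub> lift Y" "lift (X \<oplus>\<^bsub>T\<^esub> Y) = lift X \<oplus>\<^bsub>R\<^esub> lift Y"
    by (simp_all add: lift_cls flip: cls_mult cls_add)
next
  fix a X assume "a \<in> carrier A" "X \<in> carrier T"
  then show "lift (a \<odot>\<^bsub>T\<^esub> X) = a \<odot>\<^bsub>R\<^esub> lift X"
    by (auto simp: T_carrier lift_cls L.lin_smult simp flip: cls_smult)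
next
  show "lift \<one>\<^bsub>T\<^esub> = \<one>\<^bsub>R\<^esub>" by (simp add: lift_cls flip: cls_one)
qed (auto simp: T_carrier lift_cls)

end

locale tensor_power_hom = K: tensor_power_of A K n + L: tensor_power_of A L n
  for A :: "('a, 'm) ring_scheme" and K :: "('a, 'b, 'k) module_scheme"
    and L :: "('a, 'c, 'l) module_scheme" and n :: nat +
  fixes h :: "'b \<Rightarrow> 'c"
  assumes h: "h \<in> alg_hom A K L"
begin

sublocale ind: multiplicative_multilinear A K n "tensor_power A n L" "\<lambda>x. pure_tensor A n L (h \<circ> x)"
proof
  fix x y assume x: "x \<in> {..<n} \<rightarrow>\<^sub>E carrier K"
  show "L.pure (h \<circ> x) \<in> carrier L.T"
    using x alg_homD(1)[OF h] by (intro L.pure_closed) auto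
  assume y: "y \<in> {..<n} \<rightarrow>\<^sub>E carrier K"
  have "L.pure (h \<circ> x) \<otimes>\<^bsub>L.T\<^esub> L.pure (h \<circ> y) = L.pure (\<lambda>i. (h \<circ> x) i \<otimes>\<^bsub>L\<^esub> (h \<circ> y) i)"
    using x y alg_homD(1)[OF h] by (intro L.pure_mult) auto
  also have "\<dots> = L.pure (h \<circ> (\<lambda>i\<in>{..<n}. x i \<otimes>\<^bsub>K\<^esub> y i))"
    using x y alg_homD(2)[OF h] by (intro L.pure_cong) (auto simp: PiE_iff)
  finally show "L.pure (h \<circ> (\<lambda>i\<in>{..<n}. x i \<otimes>\<^bsub>K\<^esub> y i)) = L.pure (h \<circ> x) \<otimes>\<^bsub>L.T\<^esub> L.pure (h \<circ> y)"
    by (rule sym)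
next
  have "L.pure (h \<circ> (\<lambda>i\<in>{..<n}. \<one>\<^bsub>K\<^esub>)) = L.pure (\<lambda>_. \<one>\<^bsub>L\<^esub>)"
    by (rule L.pure_cong) (simp add: alg_homD(4)[OF h])
  then show "L.pure (h \<circ> (\<lambda>i\<in>{..<n}. \<one>\<^bsub>K\<^esub>)) = \<one>\<^bsub>L.T\<^esub>" by (simp add: L.pure_one)
next
  fix x i b c assume "x \<in> {..<n} \<rightarrow>\<^sub>E carrier K" "i < n" "b \<in> carrier K" "c \<in> carrier K"
  then show "L.pure (h \<circ> x(i := b \<oplus>\<^bsub>K\<^esub> c)) = L.pure (h \<circ> x(i := b)) \<oplus>\<^bsub>L.T\<^esub> L.pure (h \<circ> x(i := c))"
    using alg_homD(1)[OF h]
    by (simp add: fun_upd_comp alg_homD(3)[OF h]) (intro L.pure_add, auto)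
next
  fix x i a b assume "x \<in> {..<n} \<rightarrow>\<^sub>E carrier K" "i < n" "a \<in> carrier A" "b \<in> carrier K"
  then show "L.pure (h \<circ> x(i := a \<odot>\<^bsub>K\<^esub> b)) = a \<odot>\<^bsub>L.T\<^esub> L.pure (h \<circ> x(i := b))"
    using alg_homD(1)[OF h]
    by (simp add: fun_upd_comp alg_homD(5)[OF h]) (intro L.pure_smult, auto)
qed

abbreviation hom where "hom \<equiv> tensor_power_map A n K L h"

text \<open>All representatives of a tensor contribute the same value to the union that defines the map.\<close>

lemma hom_eq_lift:
  assumes "X \<in> carrier K.T"
  shows "hom X = ind.lift X"
proof -
  have "ind.L.lin f = ind.lift X" if "f \<in> X" for f
    using ind.lift_eq[OF assms that] by simp
  moreover obtain f where "f \<in> X"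
    using assms K.rels.a_rcos_self by (auto simp: K.T_carrier)
  ultimately show ?thesis
    unfolding tensor_power_map_def linear_extension_def by auto
qed

lemma hom_alg_hom: "hom \<in> alg_hom A K.T L.T"
  using alg_homD[OF ind.lift_alg_hom]
  by (intro alg_homI) (simp_all add: hom_eq_lift)

lemma hom_pure:
  assumes "\<And>i. i < n \<Longrightarrow> x i \<in> carrier K"
  shows "hom (K.pure x) = L.pure (\<lambda>i. h (x i))"
proof -
  have "restrict x {..<n} \<in> {..<n} \<rightarrow>\<^sub>E carrier K" using assms by auto
  then have "hom (K.pure (restrict x {..<n})) = L.pure (h \<circ> restrict x {..<n})"
    using assms by (subst hom_eq_lift) (auto simp: ind.lift_pure simp del: K.pure_restrict)
  also have "\<dots> = L.pure (\<lambda>i. h (x i))" by (rule L.pure_cong) simp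
  finally show ?thesis by simp
qed

end

section \<open>Permutations and symmetric tensors\<close>

context tensor_power_of
begin

text \<open>The symbol \<open>inv\<close> stands for the inverse in a monoid here.\<close>

abbreviation perm_inv :: "(nat \<Rightarrow> nat) \<Rightarrow> nat \<Rightarrow> nat" where "perm_inv \<equiv> inv_into UNIV"

definition permute_coeffs :: "(nat \<Rightarrow> nat) \<Rightarrow> ((nat \<Rightarrow> 'b) \<Rightarrow> 'a) \<Rightarrow> (nat \<Rightarrow> 'b) \<Rightarrow> 'a"
  where "permute_coeffs \<sigma> f = (\<lambda>x. f (x \<circ> \<sigma>))"

lemma permute_tuple:
  assumes "\<sigma> permutes {..<n}"
  shows "x \<circ> \<sigma> \<in> {..<n} \<rightarrow>\<^sub>E carrier K \<longleftrightarrow> x \<in> {..<n} \<rightarrow>\<^sub>E carrier K"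
proof -
  have *: "x \<circ> \<sigma> \<in> {..<n} \<rightarrow>\<^sub>E carrier K"
    if "x \<in> {..<n} \<rightarrow>\<^sub>E carrier K" "\<sigma> permutes {..<n}" for x and \<sigma> :: "nat \<Rightarrow> nat"
    using that permutes_in_image[OF that(2)] by (auto simp: PiE_iff extensional_def)
  show ?thesis
  proof
    assume "x \<circ> \<sigma> \<in> {..<n} \<rightarrow>\<^sub>E carrier K"
    then have "x \<circ> \<sigma> \<circ> perm_inv \<sigma> \<in> {..<n} \<rightarrow>\<^sub>E carrier K"
      by (rule *) (use assms permutes_inv in blast)
    then show "x \<in> {..<n} \<rightarrow>\<^sub>E carrier K"
      using permutes_inv_o[OF assms] by (simp add: comp_assoc)
  qed (use * assms in blast)
qed

lemma permute_coeffs_carrier [simp]: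
  assumes \<sigma>: "\<sigma> permutes {..<n}" and f: "f \<in> carrier F.AM"
  shows "permute_coeffs \<sigma> f \<in> carrier F.AM"
proof -
  have "{x. f (x \<circ> \<sigma>) \<noteq> \<zero>\<^bsub>A\<^esub>} \<subseteq> (\<lambda>y. y \<circ> perm_inv \<sigma>) ` {y. f y \<noteq> \<zero>\<^bsub>A\<^esub>}"
  proof
    fix x assume "x \<in> {x. f (x \<circ> \<sigma>) \<noteq> \<zero>\<^bsub>A\<^esub>}"
    then show "x \<in> (\<lambda>y. y \<circ> perm_inv \<sigma>) ` {y. f y \<noteq> \<zero>\<^bsub>A\<^esub>}"
      by (intro image_eqI[of _ _ "x \<circ> \<sigma>"]) (auto simp: comp_assoc permutes_inv_o[OF \<sigma>])
  qed
  then have "finite {x. f (x \<circ> \<sigma>) \<noteq> \<zero>\<^bsub>A\<^esub>}"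
    using F.AM_support(1)[OF f] finite_surj by blast
  moreover have "f (x \<circ> \<sigma>) = \<zero>\<^bsub>A\<^esub>" if "x \<notin> carrier tuples" for x
    using that f permute_tuple[OF \<sigma>] by (auto simp: F.mem_carrier_AM)
  ultimately show ?thesis
    using f unfolding permute_coeffs_def by (simp add: F.mem_carrier_AM)
qed

lemma permute_coeffs_basis:
  assumes "\<sigma> permutes {..<n}"
  shows "permute_coeffs \<sigma> (F.e x) = F.e (x \<circ> perm_inv \<sigma>)"
proof -
  have "y \<circ> \<sigma> = x \<longleftrightarrow> y = x \<circ> perm_inv \<sigma>" for y
    using permutes_inv_o[OF assms] by (auto simp: comp_assoc)
  then show ?thesis by (simp add: permute_coeffs_def basis_elt_def fun_eq_iff[where ?'b = 'a])
qed

lemma permute_coeffs_inverse: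
  assumes "\<sigma> permutes {..<n}"
  shows "permute_coeffs \<sigma> (permute_coeffs (perm_inv \<sigma>) f) = f"
  by (simp add: permute_coeffs_def comp_assoc permutes_inv_o[OF assms])

lemma permutation_multilinear:
  assumes \<sigma>: "\<sigma> permutes {..<n}"
  shows "multiplicative_multilinear A K n T (\<lambda>x. pure (x \<circ> perm_inv \<sigma>))"
proof -
  have \<sigma>': "perm_inv \<sigma> i < n \<longleftrightarrow> i < n" for i
    using permutes_in_image[OF permutes_inv[OF \<sigma>]] by simp
  have \<sigma>_lt: "\<sigma> i < n" if "i < n" for i using permutes_in_image[OF \<sigma>] that by simp
  \<comment> \<open>The \<open>i\<close>-th factor moves to position \<open>\<sigma> i\<close>.\<close>
  have upd: "x(i := b) \<circ> perm_inv \<sigma> = (x \<circ> perm_inv \<sigma>)(\<sigma> i := b)" for x :: "nat \<Rightarrow> 'b" and i b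
    using permutes_inv_eq[OF \<sigma>] by (auto simp: fun_eq_iff)
  show ?thesis
  proof
    fix x y assume x: "x \<in> {..<n} \<rightarrow>\<^sub>E carrier K"
    show "pure (x \<circ> perm_inv \<sigma>) \<in> carrier T" using x \<sigma>' by (intro pure_closed) auto
    assume y: "y \<in> {..<n} \<rightarrow>\<^sub>E carrier K"
    have "pure (x \<circ> perm_inv \<sigma>) \<otimes>\<^bsub>T\<^esub> pure (y \<circ> perm_inv \<sigma>) =
        pure (\<lambda>i. (x \<circ> perm_inv \<sigma>) i \<otimes>\<^bsub>K\<^esub> (y \<circ> perm_inv \<sigma>) i)"
      using x y \<sigma>' by (intro pure_mult) auto
    also have "\<dots> = pure ((\<lambda>i\<in>{..<n}. x i \<otimes>\<^bsub>K\<^esub> y i) \<circ> perm_inv \<sigma>)"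
      by (rule pure_cong) (simp add: \<sigma>')
    finally show "pure ((\<lambda>i\<in>{..<n}. x i \<otimes>\<^bsub>K\<^esub> y i) \<circ> perm_inv \<sigma>) =
        pure (x \<circ> perm_inv \<sigma>) \<otimes>\<^bsub>T\<^esub> pure (y \<circ> perm_inv \<sigma>)" by (rule sym)
  next
    have "pure ((\<lambda>i\<in>{..<n}. \<one>\<^bsub>K\<^esub>) \<circ> perm_inv \<sigma>) = pure (\<lambda>_. \<one>\<^bsub>K\<^esub>)"
      by (rule pure_cong) (simp add: \<sigma>')
    then show "pure ((\<lambda>i\<in>{..<n}. \<one>\<^bsub>K\<^esub>) \<circ> perm_inv \<sigma>) = \<one>\<^bsub>T\<^esub>" by (simp add: pure_one)
  next
    fix x i b assume x: "x \<in> {..<n} \<rightarrow>\<^sub>E carrier K" "i < n" "b \<in> carrier K"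
    show "pure (x(i := b \<oplus>\<^bsub>K\<^esub> c) \<circ> perm_inv \<sigma>) =
        pure (x(i := b) \<circ> perm_inv \<sigma>) \<oplus>\<^bsub>T\<^esub> pure (x(i := c) \<circ> perm_inv \<sigma>)" if "c \<in> carrier K" for c
      unfolding upd using x that \<sigma>' \<sigma>_lt by (intro pure_add) auto
    show "pure (x(i := a \<odot>\<^bsub>K\<^esub> b) \<circ> perm_inv \<sigma>) = a \<odot>\<^bsub>T\<^esub> pure (x(i := b) \<circ> perm_inv \<sigma>)"
      if "a \<in> carrier A" for a
      unfolding upd using x that \<sigma>' \<sigma>_lt by (intro pure_smult) auto
  qed
qed

text \<open>The permutation action is defined as an image of cosets. It agrees with the algebra homomorphism
given by the universal property because both come from the same map on representatives; that map
preserves the ideal of relations, since the homomorphism vanishes there, and maps the ideal onto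
itself because the inverse permutation preserves it as well.\<close>

lemma permute_tensor_eq_lift:
  assumes \<sigma>: "\<sigma> permutes {..<n}" and X: "X \<in> carrier T"
  shows "permute_tensor \<sigma> X = multiplicative_multilinear.lift A T (\<lambda>x. pure (x \<circ> perm_inv \<sigma>)) X"
proof -
  have cls_permute: "cls (permute_coeffs \<sigma> f) = multiplicative_multilinear.lift A T (\<lambda>x. pure (x \<circ> perm_inv \<sigma>)) (cls f)"
    if \<sigma>: "\<sigma> permutes {..<n}" and f: "f \<in> carrier F.AM" for \<sigma> f
  proof -
    interpret P: multiplicative_multilinear A K n T "\<lambda>x. pure (x \<circ> perm_inv \<sigma>)"
      by (rule permutation_multilinear[OF \<sigma>])
    define \<Phi> where "\<Phi> = P.lift"
    have \<Phi>: "\<Phi> \<in> alg_hom A T T" unfolding \<Phi>_def by (rule P.lift_alg_hom)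
    interpret \<Phi>: ring_hom_cring T T \<Phi>
      by (rule alg_hom_ring_hom_cring[OF \<Phi> T_algebra T_algebra])
    from f have "cls (permute_coeffs \<sigma> f) = \<Phi> (cls f)"
    proof (induction f rule: F.AM_induct)
      case zero
      have "permute_coeffs \<sigma> \<zero>\<^bsub>F.AM\<^esub> = \<zero>\<^bsub>F.AM\<^esub>" by (simp add: permute_coeffs_def F.AM_zero)
      then show ?case by (simp add: cls_zero)
    next
      case (add f a x)
      then have x: "x \<in> {..<n} \<rightarrow>\<^sub>E carrier K" and x': "x \<circ> perm_inv \<sigma> \<in> {..<n} \<rightarrow>\<^sub>E carrier K"
        using permute_tuple[OF permutes_inv[OF \<sigma>]] by simp_all
      then have e: "F.e x \<in> carrier F.AM" "F.e (x \<circ> perm_inv \<sigma>) \<in> carrier F.AM"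
        by (auto intro!: F.basis_closed)
      have "permute_coeffs \<sigma> (f \<oplus>\<^bsub>F.AM\<^esub> a \<odot>\<^bsub>F.AM\<^esub> F.e x)
          = permute_coeffs \<sigma> f \<oplus>\<^bsub>F.AM\<^esub> a \<odot>\<^bsub>F.AM\<^esub> permute_coeffs \<sigma> (F.e x)"
        by (simp add: permute_coeffs_def F.AM_add F.AM_smult)
      moreover have "\<Phi> (cls (F.e x)) = cls (F.e (x \<circ> perm_inv \<sigma>))"
        using P.lift_pure[OF x] pure_eq_cls[OF x] pure_eq_cls[OF x'] by (simp only: \<Phi>_def)
      ultimately show ?case
        using add \<sigma> e by (simp add: permute_coeffs_basis cls_add cls_smult alg_homD(5)[OF \<Phi>])
    qed
    then show ?thesis unfolding \<Phi>_def .
  qed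
  have rels: "permute_coeffs \<sigma> f \<in> rels" if "\<sigma> permutes {..<n}" "f \<in> rels" for \<sigma> f
  proof -
    interpret P: multiplicative_multilinear A K n T "\<lambda>x. pure (x \<circ> perm_inv \<sigma>)"
      by (rule permutation_multilinear[OF that(1)])
    show ?thesis
      using cls_permute[OF that(1) rels.Icarr[OF that(2)]] that rels.Icarr[OF that(2)]
      by (simp add: P.lift_cls P.lin_rels cls_eq_zero_iff)
  qed
  obtain g where g: "g \<in> carrier F.AM" "X = cls g" using X by (auto simp: T_carrier)
  have "permute_coeffs \<sigma> ` rels = rels"
  proof
    show "permute_coeffs \<sigma> ` rels \<subseteq> rels" using rels[OF \<sigma>] by blast
    show "rels \<subseteq> permute_coeffs \<sigma> ` rels"
      using rels[OF permutes_inv[OF \<sigma>]] permute_coeffs_inverse[OF \<sigma>] by (metis image_eqI subsetI)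
  qed
  moreover have coset: "cls f = (\<lambda>i. i \<oplus>\<^bsub>F.AM\<^esub> f) ` rels" for f
    unfolding a_r_coset_def' by blast
  moreover have "permute_coeffs \<sigma> (i \<oplus>\<^bsub>F.AM\<^esub> g) = permute_coeffs \<sigma> i \<oplus>\<^bsub>F.AM\<^esub> permute_coeffs \<sigma> g" for i
    by (simp add: permute_coeffs_def F.AM_add)
  then have "permute_tensor \<sigma> (cls g) = (\<lambda>i. i \<oplus>\<^bsub>F.AM\<^esub> permute_coeffs \<sigma> g) ` permute_coeffs \<sigma> ` rels"
    unfolding permute_tensor_def permute_coeffs_def[symmetric] coset by (simp add: image_image)
  ultimately have "permute_tensor \<sigma> (cls g) = cls (permute_coeffs \<sigma> g)" by (simp only:)
  then show ?thesis using cls_permute[OF \<sigma> g(1)] g(2) by (simp only:)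
qed

lemma permute_tensor_alg_hom:
  assumes \<sigma>: "\<sigma> permutes {..<n}"
  shows "permute_tensor \<sigma> \<in> alg_hom A T T"
proof -
  interpret P: multiplicative_multilinear A K n T "\<lambda>x. pure (x \<circ> perm_inv \<sigma>)"
    by (rule permutation_multilinear[OF \<sigma>])
  show ?thesis
    using alg_homD[OF P.lift_alg_hom]
    by (intro alg_homI) (simp_all add: permute_tensor_eq_lift[OF \<sigma>])
qed

lemma permute_tensor_pure:
  assumes \<sigma>: "\<sigma> permutes {..<n}" and x: "\<And>i. i < n \<Longrightarrow> x i \<in> carrier K"
  shows "permute_tensor \<sigma> (pure x) = pure (x \<circ> perm_inv \<sigma>)"
proof -
  interpret P: multiplicative_multilinear A K n T "\<lambda>x. pure (x \<circ> perm_inv \<sigma>)"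
    by (rule permutation_multilinear[OF \<sigma>])
  have "restrict x {..<n} \<in> {..<n} \<rightarrow>\<^sub>E carrier K" using x by auto
  from P.lift_pure[OF this] have "P.lift (pure x) = pure (restrict x {..<n} \<circ> perm_inv \<sigma>)" by simp
  also have "\<dots> = pure (x \<circ> perm_inv \<sigma>)"
    using permutes_in_image[OF permutes_inv[OF \<sigma>]] by (intro pure_cong) simp
  finally show ?thesis using x by (simp add: permute_tensor_eq_lift[OF \<sigma>] pure_closed)
qed

abbreviation S where "S \<equiv> symmetric_tensors A n K"

lemma S_sel:
  "carrier S = {X \<in> carrier T. \<forall>\<sigma>. \<sigma> permutes {..<n} \<longrightarrow> permute_tensor \<sigma> X = X}"
  "\<zero>\<^bsub>S\<^esub> = \<zero>\<^bsub>T\<^esub>" "\<one>\<^bsub>S\<^esub> = \<one>\<^bsub>T\<^esub>"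
  "X \<oplus>\<^bsub>S\<^esub> Y = X \<oplus>\<^bsub>T\<^esub> Y" "X \<otimes>\<^bsub>S\<^esub> Y = X \<otimes>\<^bsub>T\<^esub> Y" "a \<odot>\<^bsub>S\<^esub> X = a \<odot>\<^bsub>T\<^esub> X"
  unfolding symmetric_tensors_def by simp_all

lemma S_carrierD:
  assumes "X \<in> carrier S"
  shows "X \<in> carrier T" "\<And>\<sigma>. \<sigma> permutes {..<n} \<Longrightarrow> permute_tensor \<sigma> X = X"
  using assms unfolding S_sel by blast+

lemma S_carrierI:
  assumes "X \<in> carrier T" "\<And>\<sigma>. \<sigma> permutes {..<n} \<Longrightarrow> permute_tensor \<sigma> X = X"
  shows "X \<in> carrier S"
  using assms unfolding S_sel by blast

lemma S_closed:
  shows "\<zero>\<^bsub>T\<^esub> \<in> carrier S" "\<one>\<^bsub>T\<^esub> \<in> carrier S"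
    and "X \<in> carrier S \<Longrightarrow> \<ominus>\<^bsub>T\<^esub> X \<in> carrier S"
    and "X \<in> carrier S \<Longrightarrow> Y \<in> carrier S \<Longrightarrow> X \<oplus>\<^bsub>T\<^esub> Y \<in> carrier S"
    and "X \<in> carrier S \<Longrightarrow> Y \<in> carrier S \<Longrightarrow> X \<otimes>\<^bsub>T\<^esub> Y \<in> carrier S"
    and "a \<in> carrier A \<Longrightarrow> X \<in> carrier S \<Longrightarrow> a \<odot>\<^bsub>T\<^esub> X \<in> carrier S"
proof -
  note perm_hom = alg_hom_ring_hom_cring[OF permute_tensor_alg_hom T_algebra T_algebra]
  show "\<zero>\<^bsub>T\<^esub> \<in> carrier S"
    by (rule S_carrierI) (simp_all add: ring_hom_cring.hom_zero[OF perm_hom])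
  show "\<one>\<^bsub>T\<^esub> \<in> carrier S"
    by (rule S_carrierI) (simp_all add: alg_homD(4)[OF permute_tensor_alg_hom])
  show "\<ominus>\<^bsub>T\<^esub> X \<in> carrier S" if "X \<in> carrier S" for X
    by (rule S_carrierI)
       (simp_all add: S_carrierD[OF that] ring_hom_cring.hom_a_inv[OF perm_hom])
  show "X \<oplus>\<^bsub>T\<^esub> Y \<in> carrier S" if "X \<in> carrier S" "Y \<in> carrier S" for X Y
    by (rule S_carrierI)
       (simp_all add: S_carrierD[OF that(1)] S_carrierD[OF that(2)] alg_homD(3)[OF permute_tensor_alg_hom])
  show "X \<otimes>\<^bsub>T\<^esub> Y \<in> carrier S" if "X \<in> carrier S" "Y \<in> carrier S" for X Y
    by (rule S_carrierI)
       (simp_all add: S_carrierD[OF that(1)] S_carrierD[OF that(2)] alg_homD(2)[OF permute_tensor_alg_hom])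
  show "a \<odot>\<^bsub>T\<^esub> X \<in> carrier S" if "a \<in> carrier A" "X \<in> carrier S" for a X
    by (rule S_carrierI)
       (simp_all add: that(1) S_carrierD[OF that(2)] alg_homD(5)[OF permute_tensor_alg_hom])
qed

lemma S_cring: "cring S"
proof (rule cringI)
  note [simp] = S_sel(2-5) S_closed S_carrierD(1)
  show "abelian_group S"
  proof (rule abelian_groupI)
    fix X assume "X \<in> carrier S"
    then show "\<exists>Y\<in>carrier S. Y \<oplus>\<^bsub>S\<^esub> X = \<zero>\<^bsub>S\<^esub>"
      by (intro bexI[of _ "\<ominus>\<^bsub>T\<^esub> X"]) (simp_all add: T.l_neg)
  next
    fix X Y assume "X \<in> carrier S" "Y \<in> carrier S"
    then show "X \<oplus>\<^bsub>S\<^esub> Y = Y \<oplus>\<^bsub>S\<^esub> X"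
      unfolding S_sel(4) by (intro T.a_comm S_carrierD)
  qed (simp_all add: T.a_assoc)
  show "comm_monoid S"
  proof (rule comm_monoidI)
    fix X Y assume "X \<in> carrier S" "Y \<in> carrier S"
    then show "X \<otimes>\<^bsub>S\<^esub> Y = Y \<otimes>\<^bsub>S\<^esub> X"
      unfolding S_sel(5) by (intro T.m_comm S_carrierD)
  qed (simp_all add: T.m_assoc)
  fix X Y Z assume "X \<in> carrier S" "Y \<in> carrier S" "Z \<in> carrier S"
  then show "(X \<oplus>\<^bsub>S\<^esub> Y) \<otimes>\<^bsub>S\<^esub> Z = X \<otimes>\<^bsub>S\<^esub> Z \<oplus>\<^bsub>S\<^esub> Y \<otimes>\<^bsub>S\<^esub> Z"
    by (simp add: T.l_distr)
qed

lemma S_algebra: "algebra A S"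
  by (rule algebraI[OF A.cring_axioms S_cring])
     (simp_all add: S_sel(4-6) S_closed S_carrierD(1) T_alg.smult_l_distr T_alg.smult_r_distr
        T_alg.smult_assoc1 T_alg.smult_assoc2)

lemma pure_diagonal_symmetric:
  assumes "f \<in> carrier K"
  shows "pure (\<lambda>_. f) \<in> carrier S"
  by (rule S_carrierI) (use assms in \<open>auto simp: permute_tensor_pure comp_def\<close>)

end

section \<open>Tensor powers of a fraction ring\<close>

locale tensor_localization = loc: algebra_localization A K U
  for A :: "('a, 'm) ring_scheme" and K :: "('a, 'b, 'k) module_scheme" and U :: "'b set" +
  fixes n :: nat
begin

abbreviation Q where "Q \<equiv> frac_algebra K U"

sublocale F: tensor_power_hom A K Q n "to_frac K U"
  by (intro tensor_power_hom.intro tensor_power_hom_axioms.intro tensor_power_of.intro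
      loc.alg loc.Q_algebra loc.to_frac_alg_hom)

abbreviation T where "T \<equiv> tensor_power A n K"
abbreviation TQ where "TQ \<equiv> tensor_power A n Q"
abbreviation pure where "pure \<equiv> pure_tensor A n K"
abbreviation pureQ where "pureQ \<equiv> pure_tensor A n Q"

sublocale F: ring_hom_cring T TQ F.hom
  by (rule alg_hom_ring_hom_cring[OF F.hom_alg_hom F.K.T_algebra F.L.T_algebra])

text \<open>Clearing the denominators of a pure tensor \<open>r\<^sub>0/s\<^sub>0 \<otimes> \<dots> \<otimes> r\<^sub>n\<^sub>-\<^sub>1/s\<^sub>n\<^sub>-\<^sub>1\<close> naturally produces
\<open>s\<^sub>0 \<otimes> \<dots> \<otimes> s\<^sub>n\<^sub>-\<^sub>1\<close>, with no need for a common denominator. It is therefore convenient to localize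
first at all these tensors; as each of them divides a diagonal one
(\<open>diagonal_multiple\<close> below), the diagonal tensors give the same localization.\<close>

definition W where "W = {pure w | w. \<forall>i<n. w i \<in> U}"

lemma W_I: "(\<And>i. i < n \<Longrightarrow> w i \<in> U) \<Longrightarrow> pure w \<in> W"
  unfolding W_def by blast

lemma W_submonoid: "submonoid W T"
proof
  show "W \<subseteq> carrier T" unfolding W_def by (auto intro: F.K.pure_closed)
  show "\<one>\<^bsub>T\<^esub> \<in> W" unfolding F.K.pure_one[symmetric] by (rule W_I) (rule loc.U.one_closed)
  fix X Y assume "X \<in> W" "Y \<in> W"
  then obtain x y where "X = pure x" "Y = pure y" "\<And>i. i < n \<Longrightarrow> x i \<in> U" "\<And>i. i < n \<Longrightarrow> y i \<in> U"
    unfolding W_def by blast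
  then show "X \<otimes>\<^bsub>T\<^esub> Y \<in> W" by (simp add: F.K.pure_mult W_I)
qed

sublocale locW: algebra_localization A T W
  by (rule algebra_localization.intro[OF F.K.T_algebra W_submonoid])

no_notation locW.frac (infixl \<open>\<oslash>\<close> 70)

abbreviation TW where "TW \<equiv> frac_algebra T W"

text \<open>If \<open>t i\<close> witnesses the equality of the \<open>i\<close>-th fractions, then \<open>t 0 \<otimes> \<dots> \<otimes> t (n - 1)\<close> witnesses
the equality of the tensors.\<close>

lemma tensor_fraction_cong:
  assumes "\<And>i. i < n \<Longrightarrow> r i \<in> carrier K" "\<And>i. i < n \<Longrightarrow> s i \<in> U"
    and "\<And>i. i < n \<Longrightarrow> r' i \<in> carrier K" "\<And>i. i < n \<Longrightarrow> s' i \<in> U"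
    and eq: "\<And>i. i < n \<Longrightarrow> r i \<oslash> s i = r' i \<oslash> s' i"
  shows "fraction T W (pure r) (pure s) = fraction T W (pure r') (pure s')"
proof -
  have "\<exists>t\<in>U. t \<otimes>\<^bsub>K\<^esub> (r i \<otimes>\<^bsub>K\<^esub> s' i) = t \<otimes>\<^bsub>K\<^esub> (r' i \<otimes>\<^bsub>K\<^esub> s i)" if "i < n" for i
    using eq[OF that] assms that by (simp add: loc.frac_eq_iff)
  then obtain t where t: "\<And>i. i < n \<Longrightarrow> t i \<in> U"
      "\<And>i. i < n \<Longrightarrow> t i \<otimes>\<^bsub>K\<^esub> (r i \<otimes>\<^bsub>K\<^esub> s' i) = t i \<otimes>\<^bsub>K\<^esub> (r' i \<otimes>\<^bsub>K\<^esub> s i)"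
    by metis
  have "pure t \<otimes>\<^bsub>T\<^esub> (pure r \<otimes>\<^bsub>T\<^esub> pure s') = pure (\<lambda>i. t i \<otimes>\<^bsub>K\<^esub> (r i \<otimes>\<^bsub>K\<^esub> s' i))"
    using assms t by (simp add: F.K.pure_mult)
  also have "\<dots> = pure (\<lambda>i. t i \<otimes>\<^bsub>K\<^esub> (r' i \<otimes>\<^bsub>K\<^esub> s i))"
    by (rule F.K.pure_cong) (rule t)
  also have "\<dots> = pure t \<otimes>\<^bsub>T\<^esub> (pure r' \<otimes>\<^bsub>T\<^esub> pure s)"
    using assms t by (simp add: F.K.pure_mult)
  finally show ?thesis
    using assms t W_I[of t] W_I[of s] W_I[of s'] by (subst locW.frac_eq_iff) auto
qed

definition num where "num X = (SOME r. \<exists>s\<in>U. r \<in> carrier K \<and> X = r \<oslash> s)"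
definition den where "den X = (SOME s. s \<in> U \<and> X = num X \<oslash> s)"

lemma num_den:
  assumes "X \<in> carrier Q"
  shows "num X \<in> carrier K" "den X \<in> U" "num X \<oslash> den X = X"
proof -
  have "\<exists>r. \<exists>s\<in>U. r \<in> carrier K \<and> X = r \<oslash> s" using assms by (rule loc.frac_cases) blast
  then have num: "\<exists>s\<in>U. num X \<in> carrier K \<and> X = num X \<oslash> s" unfolding num_def by (rule someI_ex)
  then show "num X \<in> carrier K" by blast
  have "\<exists>s. s \<in> U \<and> X = num X \<oslash> s" using num by blast
  then have "den X \<in> U \<and> X = num X \<oslash> den X" unfolding den_def by (rule someI_ex)
  then show "den X \<in> U" "num X \<oslash> den X = X" by simp_all
qed

text \<open>The homomorphism that this map induces runs in the direction opposite to the canonical one and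
detects the kernel of the latter. The choice of numerators and denominators does not matter
(\<open>gather_eq\<close> below), so that each property can be verified with representatives adapted to it.\<close>

definition gather where
  "gather x = fraction T W (pure (\<lambda>i. num (x i))) (pure (\<lambda>i. den (x i)))"

lemma gather_eq:
  assumes "\<And>i. i < n \<Longrightarrow> r i \<in> carrier K" "\<And>i. i < n \<Longrightarrow> s i \<in> U" "\<And>i. i < n \<Longrightarrow> x i = r i \<oslash> s i"
  shows "gather x = fraction T W (pure r) (pure s)"
proof -
  have "x i \<in> carrier Q" if "i < n" for i using assms that by simp
  then show ?thesis
    unfolding gather_def by (intro tensor_fraction_cong) (simp_all add: assms num_den)
qed

sublocale gather: multiplicative_multilinear A Q n TW gather
proof (intro multiplicative_multilinear.intro multiplicative_multilinear_axioms.intro)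
  show "tensor_power_of A Q" by (rule F.L.tensor_power_of_axioms)
  show "algebra A TW" by (rule locW.Q_algebra)
  have PiE_nth: "x i \<in> carrier Q" if "x \<in> {..<n} \<rightarrow>\<^sub>E carrier Q" "i < n" for x i
    using that by auto
  show "gather x \<in> carrier TW" if "x \<in> {..<n} \<rightarrow>\<^sub>E carrier Q" for x
    unfolding gather_def using that
    by (intro locW.frac_closed F.K.pure_closed W_I) (auto simp: num_den PiE_nth)
  show "gather (\<lambda>i\<in>{..<n}. x i \<otimes>\<^bsub>Q\<^esub> y i) = gather x \<otimes>\<^bsub>TW\<^esub> gather y"
    if x: "x \<in> {..<n} \<rightarrow>\<^sub>E carrier Q" and y: "y \<in> {..<n} \<rightarrow>\<^sub>E carrier Q" for x y
  proof -
    note nd = num_den[OF PiE_nth[OF x]] num_den[OF PiE_nth[OF y]]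
    have "gather x \<otimes>\<^bsub>TW\<^esub> gather y =
        fraction T W (pure (\<lambda>i. num (x i) \<otimes>\<^bsub>K\<^esub> num (y i))) (pure (\<lambda>i. den (x i) \<otimes>\<^bsub>K\<^esub> den (y i)))"
      unfolding gather_def using nd by (simp add: F.K.pure_closed W_I F.K.pure_mult)
    also have "\<dots> = gather (\<lambda>i\<in>{..<n}. x i \<otimes>\<^bsub>Q\<^esub> y i)"
    proof (rule gather_eq[symmetric])
      fix i assume i: "i < n"
      have "x i \<otimes>\<^bsub>Q\<^esub> y i = (num (x i) \<oslash> den (x i)) \<otimes>\<^bsub>Q\<^esub> (num (y i) \<oslash> den (y i))"
        using nd i by simp
      also have "\<dots> = (num (x i) \<otimes>\<^bsub>K\<^esub> num (y i)) \<oslash> (den (x i) \<otimes>\<^bsub>K\<^esub> den (y i))"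
        using nd i by (intro loc.frac_mult)
      finally show "(\<lambda>i\<in>{..<n}. x i \<otimes>\<^bsub>Q\<^esub> y i) i = (num (x i) \<otimes>\<^bsub>K\<^esub> num (y i)) \<oslash> (den (x i) \<otimes>\<^bsub>K\<^esub> den (y i))"
        using i by simp
    qed (use nd in auto)
    finally show ?thesis by (rule sym)
  qed
  have "gather (\<lambda>i\<in>{..<n}. \<one>\<^bsub>Q\<^esub>) = fraction T W (pure (\<lambda>_. \<one>\<^bsub>K\<^esub>)) (pure (\<lambda>_. \<one>\<^bsub>K\<^esub>))"
    by (rule gather_eq) (simp_all add: loc.frac_one loc.U.one_closed)
  then show "gather (\<lambda>i\<in>{..<n}. \<one>\<^bsub>Q\<^esub>) = \<one>\<^bsub>TW\<^esub>"
    by (simp add: F.K.pure_one locW.frac_one)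
  have gather_upd: "gather (x(i := p \<oslash> q)) =
      fraction T W (pure ((\<lambda>j. num (x j))(i := p))) (pure ((\<lambda>j. den (x j))(i := q)))"
    if x: "x \<in> {..<n} \<rightarrow>\<^sub>E carrier Q" and "p \<in> carrier K" "q \<in> U" for x i p q
    by (rule gather_eq) (use that num_den[OF PiE_nth[OF x]] in auto)
  show "gather (x(i := b \<oplus>\<^bsub>Q\<^esub> c)) = gather (x(i := b)) \<oplus>\<^bsub>TW\<^esub> gather (x(i := c))"
    if x: "x \<in> {..<n} \<rightarrow>\<^sub>E carrier Q" and i: "i < n" and "b \<in> carrier Q" "c \<in> carrier Q" for x i b c
  proof -
    obtain p q where b: "p \<in> carrier K" "q \<in> U" "b = p \<oslash> q" using \<open>b \<in> carrier Q\<close> by (rule loc.frac_cases)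
    obtain p' q' where c: "p' \<in> carrier K" "q' \<in> U" "c = p' \<oslash> q'" using \<open>c \<in> carrier Q\<close> by (rule loc.frac_cases)
    note nd = num_den[OF PiE_nth[OF x]]
    let ?r = "\<lambda>j. num (x j)" and ?s = "(\<lambda>j. den (x j))(i := q \<otimes>\<^bsub>K\<^esub> q')"
    \<comment> \<open>Only the position where the two tuples differ needs a common denominator.\<close>
    have b': "b = (p \<otimes>\<^bsub>K\<^esub> q') \<oslash> (q \<otimes>\<^bsub>K\<^esub> q')"
      unfolding b(3) using b(1,2) c(1,2) by (intro loc.frac_eqI) (auto simp: loc.K.m_ac)
    have c': "c = (p' \<otimes>\<^bsub>K\<^esub> q) \<oslash> (q \<otimes>\<^bsub>K\<^esub> q')"
      unfolding c(3) using b(1,2) c(1,2) by (intro loc.frac_eqI) (auto simp: loc.K.m_ac)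
    have bc: "b \<oplus>\<^bsub>Q\<^esub> c = (p \<otimes>\<^bsub>K\<^esub> q' \<oplus>\<^bsub>K\<^esub> p' \<otimes>\<^bsub>K\<^esub> q) \<oslash> (q \<otimes>\<^bsub>K\<^esub> q')"
      unfolding b(3) c(3) using b(1,2) c(1,2) by (intro loc.frac_add)
    have s: "pure ?s \<in> W" using nd b c by (intro W_I) auto
    have r: "pure (?r(i := d)) \<in> carrier T" if "d \<in> carrier K" for d
      using nd that by (intro F.K.pure_closed) auto
    have "gather (x(i := b \<oplus>\<^bsub>Q\<^esub> c)) = fraction T W (pure (?r(i := p \<otimes>\<^bsub>K\<^esub> q' \<oplus>\<^bsub>K\<^esub> p' \<otimes>\<^bsub>K\<^esub> q))) (pure ?s)"
      unfolding bc using x b(1,2) c(1,2) by (intro gather_upd) auto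
    also have "pure (?r(i := p \<otimes>\<^bsub>K\<^esub> q' \<oplus>\<^bsub>K\<^esub> p' \<otimes>\<^bsub>K\<^esub> q)) =
        pure (?r(i := p \<otimes>\<^bsub>K\<^esub> q')) \<oplus>\<^bsub>T\<^esub> pure (?r(i := p' \<otimes>\<^bsub>K\<^esub> q))"
      using nd i b c by (intro F.K.pure_add) auto
    also have "fraction T W \<dots> (pure ?s) = fraction T W (pure (?r(i := p \<otimes>\<^bsub>K\<^esub> q'))) (pure ?s)
        \<oplus>\<^bsub>TW\<^esub> fraction T W (pure (?r(i := p' \<otimes>\<^bsub>K\<^esub> q))) (pure ?s)"
      using b c s by (intro locW.frac_add_same_denominator[symmetric] r) auto
    also have "\<dots> = gather (x(i := b)) \<oplus>\<^bsub>TW\<^esub> gather (x(i := c))"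
      unfolding b' c' using x b(1,2) c(1,2) by (subst (1 2) gather_upd) auto
    finally show ?thesis .
  qed
  show "gather (x(i := a \<odot>\<^bsub>Q\<^esub> b)) = a \<odot>\<^bsub>TW\<^esub> gather (x(i := b))"
    if x: "x \<in> {..<n} \<rightarrow>\<^sub>E carrier Q" and i: "i < n" and a: "a \<in> carrier A" and "b \<in> carrier Q" for x i a b
  proof -
    obtain p q where b: "p \<in> carrier K" "q \<in> U" "b = p \<oslash> q" using \<open>b \<in> carrier Q\<close> by (rule loc.frac_cases)
    note nd = num_den[OF PiE_nth[OF x]]
    let ?r = "\<lambda>j. num (x j)" and ?s = "(\<lambda>j. den (x j))(i := q)"
    have s: "pure ?s \<in> W" using nd b by (intro W_I) auto
    have r: "pure (?r(i := p)) \<in> carrier T" using nd b by (intro F.K.pure_closed) auto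
    have "a \<odot>\<^bsub>Q\<^esub> b = (a \<odot>\<^bsub>K\<^esub> p) \<oslash> q" using a b by simp
    then have "gather (x(i := a \<odot>\<^bsub>Q\<^esub> b)) = fraction T W (pure (?r(i := a \<odot>\<^bsub>K\<^esub> p))) (pure ?s)"
      using x a b by (simp only:) (intro gather_upd, auto)
    also have "pure (?r(i := a \<odot>\<^bsub>K\<^esub> p)) = a \<odot>\<^bsub>T\<^esub> pure (?r(i := p))"
      using nd i a b by (intro F.K.pure_smult) auto
    also have "fraction T W \<dots> (pure ?s) = a \<odot>\<^bsub>TW\<^esub> fraction T W (pure (?r(i := p))) (pure ?s)"
      by (intro locW.frac_smult[symmetric] a r s)
    also have "\<dots> = a \<odot>\<^bsub>TW\<^esub> gather (x(i := b))"
      unfolding b(3) using x b(1,2) by (subst gather_upd) auto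
    finally show ?thesis .
  qed
qed

text \<open>Both sides are algebra homomorphisms, and on a pure tensor all denominators are \<open>1\<close>.\<close>

lemma gather_hom:
  assumes "X \<in> carrier T"
  shows "gather.lift (F.hom X) = to_frac T W X"
proof -
  have "(gather.lift \<circ> F.hom) X = to_frac T W X"
  proof (rule F.K.alg_hom_eqI[OF _ locW.to_frac_alg_hom locW.Q_algebra _ assms])
    show "gather.lift \<circ> F.hom \<in> alg_hom A T TW"
      by (rule alg_hom_comp[OF F.hom_alg_hom gather.lift_alg_hom])
    fix x assume x: "x \<in> {..<n} \<rightarrow>\<^sub>E carrier K"
    let ?y = "\<lambda>i\<in>{..<n}. to_frac K U (x i)"
    have y: "?y \<in> {..<n} \<rightarrow>\<^sub>E carrier Q"
      using x alg_homD(1)[OF loc.to_frac_alg_hom] by auto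
    have "F.hom (pure x) = pureQ ?y"
      using x by (subst F.hom_pure) auto
    then have "gather.lift (F.hom (pure x)) = gather ?y" using gather.lift_pure[OF y] by (simp only:)
    also have "\<dots> = fraction T W (pure x) (pure (\<lambda>_. \<one>\<^bsub>K\<^esub>))"
      by (rule gather_eq) (use x in \<open>auto simp: to_frac_def loc.U.one_closed\<close>)
    also have "\<dots> = to_frac T W (pure x)" by (simp add: to_frac_def F.K.pure_one)
    finally show "(gather.lift \<circ> F.hom) (pure x) = to_frac T W (pure x)" by simp
  qed
  then show ?thesis by simp
qed

lemma diagonal_multiple:
  assumes "w \<in> W"
  shows "\<exists>c\<in>W. \<exists>u\<in>U. c \<otimes>\<^bsub>T\<^esub> w = pure (\<lambda>_. u)"
proof -
  obtain v where v: "w = pure v" "\<And>i. i < n \<Longrightarrow> v i \<in> U" using assms unfolding W_def by blast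
  then obtain u where u: "u \<in> U" "\<forall>i\<in>{..<n}. \<exists>c\<in>U. c \<otimes>\<^bsub>K\<^esub> v i = u"
    using loc.common_multiple[of "{..<n}" v] by auto
  then obtain c where c: "\<And>i. i < n \<Longrightarrow> c i \<in> U" "\<And>i. i < n \<Longrightarrow> c i \<otimes>\<^bsub>K\<^esub> v i = u"
    by (metis lessThan_iff)
  have "pure c \<otimes>\<^bsub>T\<^esub> w = pure (\<lambda>i. c i \<otimes>\<^bsub>K\<^esub> v i)"
    using v c by (simp add: F.K.pure_mult)
  also have "\<dots> = pure (\<lambda>_. u)" by (rule F.K.pure_cong) (rule c)
  finally show ?thesis using c u W_I by blast
qed

text \<open>If the image of \<open>X\<close> vanishes, then so does \<open>X / 1\<close> by the preceding comparison, that is, \<open>X\<close> is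
killed by a pure tensor with entries in \<open>U\<close>, and hence by a diagonal multiple of it.\<close>

lemma hom_kernel:
  assumes X: "X \<in> carrier T" and 0: "F.hom X = \<zero>\<^bsub>TQ\<^esub>"
  shows "\<exists>u\<in>U. pure (\<lambda>_. u) \<otimes>\<^bsub>T\<^esub> X = \<zero>\<^bsub>T\<^esub>"
proof -
  interpret gather: ring_hom_cring TQ TW gather.lift
    by (rule alg_hom_ring_hom_cring[OF gather.lift_alg_hom F.L.T_algebra locW.Q_algebra])
  have "to_frac T W X = \<zero>\<^bsub>TW\<^esub>"
    using gather_hom[OF X] 0 by simp
  then obtain w where w: "w \<in> W" "w \<otimes>\<^bsub>T\<^esub> X = \<zero>\<^bsub>T\<^esub>"
    using locW.to_frac_eq_zero[OF X] by blast
  obtain c u where c: "c \<in> W" "u \<in> U" "c \<otimes>\<^bsub>T\<^esub> w = pure (\<lambda>_. u)"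
    using diagonal_multiple[OF w(1)] by blast
  have "pure (\<lambda>_. u) \<otimes>\<^bsub>T\<^esub> X = c \<otimes>\<^bsub>T\<^esub> (w \<otimes>\<^bsub>T\<^esub> X)"
    unfolding c(3)[symmetric] using X c(1) w(1) by (intro F.K.T.m_assoc) auto
  also have "\<dots> = \<zero>\<^bsub>T\<^esub>" using c(1) w(2) by simp
  finally show ?thesis using c(2) by blast
qed

lemma clear_denominators:
  assumes "Y \<in> carrier TQ"
  shows "\<exists>X\<in>carrier T. \<exists>w\<in>W. F.hom w \<otimes>\<^bsub>TQ\<^esub> Y = F.hom X"
  using assms
proof (induction Y rule: F.L.T_induct)
  case zero
  then show ?case
    using locW.U.one_closed by (intro bexI[of _ "\<zero>\<^bsub>T\<^esub>"] bexI[of _ "\<one>\<^bsub>T\<^esub>"]) auto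
next
  case (add Y a x)
  then obtain X w where X: "X \<in> carrier T" "w \<in> W" "F.hom w \<otimes>\<^bsub>TQ\<^esub> Y = F.hom X" by blast
  have Y: "Y \<in> carrier TQ" and a: "a \<in> carrier A" using add by simp_all
  have nd: "num (x i) \<in> carrier K" "den (x i) \<in> U" "num (x i) \<oslash> den (x i) = x i"
    and xQ: "x i \<in> carrier Q" if "i < n" for i
    using add that num_den[of "x i"] by auto
  let ?r = "pure (\<lambda>i. num (x i))" and ?s = "pure (\<lambda>i. den (x i))"
  have s: "?s \<in> W" using nd by (intro W_I) auto
  have c: "?r \<in> carrier T" "?s \<in> carrier T" "w \<in> carrier T" "pureQ x \<in> carrier TQ"
    using nd xQ s X(2) by auto
  have "F.hom ?s \<otimes>\<^bsub>TQ\<^esub> pureQ x = pureQ (\<lambda>i. to_frac K U (den (x i)) \<otimes>\<^bsub>Q\<^esub> x i)"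
    using nd xQ alg_homD(1)[OF loc.to_frac_alg_hom]
    by (simp add: F.hom_pure F.L.pure_mult)
  also have "\<dots> = pureQ (\<lambda>i. to_frac K U (num (x i)))"
  proof (rule F.L.pure_cong)
    fix i assume i: "i < n"
    note nd = nd[OF i]
    have "to_frac K U (den (x i)) \<otimes>\<^bsub>Q\<^esub> (num (x i) \<oslash> den (x i)) = to_frac K U (num (x i))"
      unfolding to_frac_def using nd(1,2) loc.U.one_closed
      by (simp, intro loc.frac_eqI) (simp_all add: loc.K.m_comm)
    then show "to_frac K U (den (x i)) \<otimes>\<^bsub>Q\<^esub> x i = to_frac K U (num (x i))" using nd(3) by simp
  qed
  also have "\<dots> = F.hom ?r" using nd by (simp add: F.hom_pure)
  finally have x: "F.hom ?s \<otimes>\<^bsub>TQ\<^esub> pureQ x = F.hom ?r" .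
  have "F.hom (w \<otimes>\<^bsub>T\<^esub> ?s) \<otimes>\<^bsub>TQ\<^esub> (Y \<oplus>\<^bsub>TQ\<^esub> a \<odot>\<^bsub>TQ\<^esub> pureQ x)
      = F.hom ?s \<otimes>\<^bsub>TQ\<^esub> (F.hom w \<otimes>\<^bsub>TQ\<^esub> Y) \<oplus>\<^bsub>TQ\<^esub> F.hom w \<otimes>\<^bsub>TQ\<^esub> (a \<odot>\<^bsub>TQ\<^esub> (F.hom ?s \<otimes>\<^bsub>TQ\<^esub> pureQ x))"
  proof -
    have "a \<odot>\<^bsub>TQ\<^esub> (F.hom ?s \<otimes>\<^bsub>TQ\<^esub> pureQ x) = F.hom ?s \<otimes>\<^bsub>TQ\<^esub> (a \<odot>\<^bsub>TQ\<^esub> pureQ x)"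
      using c a by (simp add: F.L.T.m_comm[of "F.hom ?s"] F.L.T_alg.smult_assoc2)
    then show ?thesis using c Y a by (simp add: F.L.T.r_distr F.L.T.m_ac)
  qed
  also have "\<dots> = F.hom (?s \<otimes>\<^bsub>T\<^esub> X \<oplus>\<^bsub>T\<^esub> w \<otimes>\<^bsub>T\<^esub> (a \<odot>\<^bsub>T\<^esub> ?r))"
    using c X(1) a by (simp add: X(3) x alg_homD(5)[OF F.hom_alg_hom])
  finally show ?case
    using c X s a by (intro bexI[of _ "?s \<otimes>\<^bsub>T\<^esub> X \<oplus>\<^bsub>T\<^esub> w \<otimes>\<^bsub>T\<^esub> (a \<odot>\<^bsub>T\<^esub> ?r)"] bexI[of _ "w \<otimes>\<^bsub>T\<^esub> ?s"]) auto
qed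

lemma clear_denominators_diagonal:
  assumes Y: "Y \<in> carrier TQ"
  shows "\<exists>X\<in>carrier T. \<exists>u\<in>U. F.hom (pure (\<lambda>_. u)) \<otimes>\<^bsub>TQ\<^esub> Y = F.hom X"
proof -
  obtain X w where X: "X \<in> carrier T" "w \<in> W" "F.hom w \<otimes>\<^bsub>TQ\<^esub> Y = F.hom X"
    using clear_denominators[OF Y] by blast
  obtain c u where c: "c \<in> W" "u \<in> U" "c \<otimes>\<^bsub>T\<^esub> w = pure (\<lambda>_. u)"
    using diagonal_multiple[OF X(2)] by blast
  have "F.hom (pure (\<lambda>_. u)) \<otimes>\<^bsub>TQ\<^esub> Y = F.hom c \<otimes>\<^bsub>TQ\<^esub> (F.hom w \<otimes>\<^bsub>TQ\<^esub> Y)"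
    unfolding c(3)[symmetric] using c(1) X(2) Y by (simp add: F.L.T.m_assoc)
  also have "\<dots> = F.hom (c \<otimes>\<^bsub>T\<^esub> X)" using c(1) X by simp
  finally show ?thesis using c X by (intro bexI[of _ "c \<otimes>\<^bsub>T\<^esub> X"] bexI[of _ u]) auto
qed

section \<open>Symmetric tensors of a fraction ring\<close>

abbreviation S where "S \<equiv> symmetric_tensors A n K"
abbreviation SQ where "SQ \<equiv> symmetric_tensors A n Q"
abbreviation D where "D \<equiv> diagonal_tensors A n K U"

lemma hom_equivariant:
  assumes \<sigma>: "\<sigma> permutes {..<n}" and X: "X \<in> carrier T"
  shows "F.hom (permute_tensor \<sigma> X) = permute_tensor \<sigma> (F.hom X)"
proof -
  have "(F.hom \<circ> permute_tensor \<sigma>) X = (permute_tensor \<sigma> \<circ> F.hom) X"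
  proof (rule F.K.alg_hom_eqI[OF _ _ F.L.T_algebra _ X])
    show "F.hom \<circ> permute_tensor \<sigma> \<in> alg_hom A T TQ"
      by (rule alg_hom_comp[OF F.K.permute_tensor_alg_hom[OF \<sigma>] F.hom_alg_hom])
    show "permute_tensor \<sigma> \<circ> F.hom \<in> alg_hom A T TQ"
      by (rule alg_hom_comp[OF F.hom_alg_hom F.L.permute_tensor_alg_hom[OF \<sigma>]])
    fix x assume "x \<in> {..<n} \<rightarrow>\<^sub>E carrier K"
    then have x: "x i \<in> carrier K" if "i < n" for i using that by auto
    have \<sigma>': "inv_into UNIV \<sigma> i < n" if "i < n" for i
      using permutes_in_image[OF permutes_inv[OF \<sigma>]] that by simp
    show "(F.hom \<circ> permute_tensor \<sigma>) (pure x) = (permute_tensor \<sigma> \<circ> F.hom) (pure x)"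
      using x \<sigma>' alg_homD(1)[OF loc.to_frac_alg_hom]
      by (simp add: F.K.permute_tensor_pure[OF \<sigma>] F.L.permute_tensor_pure[OF \<sigma>] F.hom_pure comp_def)
  qed
  then show ?thesis by simp
qed

lemma D_submonoid: "submonoid D S"
proof
  show "D \<subseteq> carrier S"
    unfolding diagonal_tensors_def by (auto intro: F.K.pure_diagonal_symmetric)
  show "\<one>\<^bsub>S\<^esub> \<in> D"
    unfolding diagonal_tensors_def F.K.S_sel F.K.pure_one[symmetric] using loc.U.one_closed by blast
  fix X Y assume "X \<in> D" "Y \<in> D"
  then obtain f g where "X = pure (\<lambda>_. f)" "Y = pure (\<lambda>_. g)" "f \<in> U" "g \<in> U"
    unfolding diagonal_tensors_def by blast
  then have "X \<otimes>\<^bsub>S\<^esub> Y = pure (\<lambda>_. f \<otimes>\<^bsub>K\<^esub> g)" "f \<otimes>\<^bsub>K\<^esub> g \<in> U"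
    by (simp_all add: F.K.S_sel F.K.pure_mult)
  then show "X \<otimes>\<^bsub>S\<^esub> Y \<in> D"
    unfolding diagonal_tensors_def by blast
qed

lemma hom_symmetric_alg_hom: "F.hom \<in> alg_hom A S SQ"
proof (rule alg_homI)
  fix X assume X: "X \<in> carrier S"
  show "F.hom X \<in> carrier SQ"
    by (rule F.L.S_carrierI)
       (simp_all add: F.K.S_carrierD[OF X] hom_equivariant[symmetric])
next
  fix a X assume "a \<in> carrier A" "X \<in> carrier S"
  then show "F.hom (a \<odot>\<^bsub>S\<^esub> X) = a \<odot>\<^bsub>SQ\<^esub> F.hom X"
    by (simp add: F.K.S_sel(6) F.L.S_sel(6) alg_homD(5)[OF F.hom_alg_hom] F.K.S_carrierD)
qed (simp_all add: F.K.S_sel(2-5) F.L.S_sel(2-5) F.K.S_carrierD)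

lemma diagonal_unit:
  assumes "u \<in> U"
  shows "F.hom (pure (\<lambda>_. u)) \<in> Units SQ"
proof -
  interpret SQ: cring SQ by (rule F.L.S_cring)
  have u: "to_frac K U u \<in> carrier Q" and u': "\<one>\<^bsub>K\<^esub> \<oslash> u \<in> carrier Q"
    using assms alg_homD(1)[OF loc.to_frac_alg_hom] by auto
  have "to_frac K U u \<otimes>\<^bsub>Q\<^esub> (\<one>\<^bsub>K\<^esub> \<oslash> u) = \<one>\<^bsub>Q\<^esub>"
    unfolding to_frac_def loc.frac_one using assms loc.U.one_closed
    by (simp, intro loc.frac_eqI) simp_all
  then have "F.hom (pure (\<lambda>_. u)) \<otimes>\<^bsub>SQ\<^esub> pureQ (\<lambda>_. \<one>\<^bsub>K\<^esub> \<oslash> u) = \<one>\<^bsub>SQ\<^esub>"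
    using assms u u' by (simp add: F.hom_pure F.L.S_sel F.L.pure_mult F.L.pure_one)
  moreover have "pureQ (\<lambda>_. \<one>\<^bsub>K\<^esub> \<oslash> u) \<in> carrier SQ" using u' by (rule F.L.pure_diagonal_symmetric)
  moreover have "F.hom (pure (\<lambda>_. u)) \<in> carrier SQ"
    using assms alg_homD(1)[OF hom_symmetric_alg_hom] F.K.pure_diagonal_symmetric by blast
  ultimately show ?thesis
    unfolding Units_def using SQ.m_comm by auto
qed

text \<open>A tensor with invariant image need not be invariant itself: it differs from its permutations by
elements of the kernel. As there are only finitely many permutations, a single diagonal tensor
kills all these differences.\<close>

lemma common_symmetrizer:
  assumes X: "X \<in> carrier T" and "finite P"
    and P: "\<And>\<sigma>. \<sigma> \<in> P \<Longrightarrow> \<sigma> permutes {..<n} \<and> F.hom (permute_tensor \<sigma> X) = F.hom X"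
  shows "\<exists>u\<in>U. \<forall>\<sigma>\<in>P. pure (\<lambda>_. u) \<otimes>\<^bsub>T\<^esub> permute_tensor \<sigma> X = pure (\<lambda>_. u) \<otimes>\<^bsub>T\<^esub> X"
  using assms(2) P
proof (induction P rule: finite_induct)
  case empty
  then show ?case using loc.U.one_closed by blast
next
  case (insert \<sigma> P)
  have "\<exists>u\<in>U. \<forall>\<tau>\<in>P. pure (\<lambda>_. u) \<otimes>\<^bsub>T\<^esub> permute_tensor \<tau> X = pure (\<lambda>_. u) \<otimes>\<^bsub>T\<^esub> X"
    by (rule insert.IH) (use insert.prems in blast)
  then obtain u where u: "u \<in> U"
      "\<And>\<tau>. \<tau> \<in> P \<Longrightarrow> pure (\<lambda>_. u) \<otimes>\<^bsub>T\<^esub> permute_tensor \<tau> X = pure (\<lambda>_. u) \<otimes>\<^bsub>T\<^esub> X"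
    by blast
  have \<sigma>: "\<sigma> permutes {..<n}" "F.hom (permute_tensor \<sigma> X) = F.hom X" using insert.prems by auto
  have c: "permute_tensor \<tau> X \<in> carrier T" if "\<tau> permutes {..<n}" for \<tau>
    using alg_homD(1)[OF F.K.permute_tensor_alg_hom[OF that] X] .
  have "F.hom (permute_tensor \<sigma> X \<ominus>\<^bsub>T\<^esub> X) = \<zero>\<^bsub>TQ\<^esub>"
    using c[OF \<sigma>(1)] X \<sigma>(2) by (simp add: a_minus_def F.L.T.r_neg)
  then obtain v where v: "v \<in> U" "pure (\<lambda>_. v) \<otimes>\<^bsub>T\<^esub> (permute_tensor \<sigma> X \<ominus>\<^bsub>T\<^esub> X) = \<zero>\<^bsub>T\<^esub>"
    using hom_kernel[of "permute_tensor \<sigma> X \<ominus>\<^bsub>T\<^esub> X"] c[OF \<sigma>(1)] X by auto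
  have uv: "pure (\<lambda>_. u) \<in> carrier T" "pure (\<lambda>_. v) \<in> carrier T" using u v by auto
  have v': "pure (\<lambda>_. v) \<otimes>\<^bsub>T\<^esub> permute_tensor \<sigma> X = pure (\<lambda>_. v) \<otimes>\<^bsub>T\<^esub> X"
  proof -
    have "pure (\<lambda>_. v) \<otimes>\<^bsub>T\<^esub> permute_tensor \<sigma> X \<ominus>\<^bsub>T\<^esub> pure (\<lambda>_. v) \<otimes>\<^bsub>T\<^esub> X = \<zero>\<^bsub>T\<^esub>"
      using v(2) uv c[OF \<sigma>(1)] X by (simp add: F.K.T.r_distr F.K.T.r_minus a_minus_def)
    then have "\<ominus>\<^bsub>T\<^esub> (\<ominus>\<^bsub>T\<^esub> (pure (\<lambda>_. v) \<otimes>\<^bsub>T\<^esub> X)) = pure (\<lambda>_. v) \<otimes>\<^bsub>T\<^esub> permute_tensor \<sigma> X"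
      unfolding a_minus_def using uv c[OF \<sigma>(1)] X by (intro F.K.T.minus_equality) auto
    then show ?thesis using uv X by simp
  qed
  have prod: "pure (\<lambda>_. u \<otimes>\<^bsub>K\<^esub> v) = pure (\<lambda>_. u) \<otimes>\<^bsub>T\<^esub> pure (\<lambda>_. v)"
    using u v by (simp add: F.K.pure_mult)
  have "pure (\<lambda>_. u \<otimes>\<^bsub>K\<^esub> v) \<otimes>\<^bsub>T\<^esub> permute_tensor \<tau> X = pure (\<lambda>_. u \<otimes>\<^bsub>K\<^esub> v) \<otimes>\<^bsub>T\<^esub> X"
    if \<tau>: "\<tau> \<in> insert \<sigma> P" for \<tau>
  proof (cases "\<tau> = \<sigma>")
    case True
    have "pure (\<lambda>_. u \<otimes>\<^bsub>K\<^esub> v) \<otimes>\<^bsub>T\<^esub> permute_tensor \<sigma> X = pure (\<lambda>_. u) \<otimes>\<^bsub>T\<^esub> (pure (\<lambda>_. v) \<otimes>\<^bsub>T\<^esub> permute_tensor \<sigma> X)"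
      unfolding prod by (intro F.K.T.m_assoc uv c \<sigma>)
    also have "\<dots> = pure (\<lambda>_. u \<otimes>\<^bsub>K\<^esub> v) \<otimes>\<^bsub>T\<^esub> X"
      unfolding prod v' by (intro F.K.T.m_assoc[symmetric] uv X)
    finally show ?thesis unfolding True .
  next
    case False
    then have \<tau>: "\<tau> \<in> P" "\<tau> permutes {..<n}" using \<tau> insert.prems by auto
    have swap: "pure (\<lambda>_. u \<otimes>\<^bsub>K\<^esub> v) = pure (\<lambda>_. v) \<otimes>\<^bsub>T\<^esub> pure (\<lambda>_. u)"
      unfolding prod by (intro F.K.T.m_comm uv)
    have "pure (\<lambda>_. u \<otimes>\<^bsub>K\<^esub> v) \<otimes>\<^bsub>T\<^esub> permute_tensor \<tau> X = pure (\<lambda>_. v) \<otimes>\<^bsub>T\<^esub> (pure (\<lambda>_. u) \<otimes>\<^bsub>T\<^esub> permute_tensor \<tau> X)"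
      unfolding swap by (intro F.K.T.m_assoc uv c \<tau>)
    also have "\<dots> = pure (\<lambda>_. u \<otimes>\<^bsub>K\<^esub> v) \<otimes>\<^bsub>T\<^esub> X"
      unfolding swap u(2)[OF \<tau>(1)] by (intro F.K.T.m_assoc[symmetric] uv X)
    finally show ?thesis .
  qed
  then show ?case using u v by (intro bexI[of _ "u \<otimes>\<^bsub>K\<^esub> v"]) auto
qed

text \<open>The numerator \<open>X\<close> obtained for \<open>Y\<close> in the full tensor power has a symmetric image, because \<open>Y\<close> and
the diagonal denominator are symmetric. Multiplying numerator and denominator by a further diagonal
tensor makes the numerator symmetric.\<close>

lemma clear_denominators_symmetric:
  assumes Y: "Y \<in> carrier SQ"
  shows "\<exists>X\<in>carrier S. \<exists>d\<in>D. F.hom d \<otimes>\<^bsub>SQ\<^esub> Y = F.hom X"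
proof -
  note YT = F.L.S_carrierD(1)[OF Y]
  obtain X u where X: "X \<in> carrier T" and u: "u \<in> U" and uY: "F.hom (pure (\<lambda>_. u)) \<otimes>\<^bsub>TQ\<^esub> Y = F.hom X"
    using clear_denominators_diagonal[OF YT] by blast
  have diag: "pure (\<lambda>_. f) \<in> carrier S" if "f \<in> U" for f
    using that by (intro F.K.pure_diagonal_symmetric) auto
  have "F.hom X \<in> carrier SQ"
    using F.L.S_closed(5)[OF alg_homD(1)[OF hom_symmetric_alg_hom diag[OF u]] Y] uY by simp
  then have "F.hom (permute_tensor \<sigma> X) = F.hom X" if "\<sigma> permutes {..<n}" for \<sigma>
    using hom_equivariant[OF that X] F.L.S_carrierD(2)[OF _ that] by simp
  then obtain v where v: "v \<in> U" and
    inv: "\<And>\<sigma>. \<sigma> permutes {..<n} \<Longrightarrow> pure (\<lambda>_. v) \<otimes>\<^bsub>T\<^esub> permute_tensor \<sigma> X = pure (\<lambda>_. v) \<otimes>\<^bsub>T\<^esub> X"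
    using common_symmetrizer[OF X finite_permutations[OF finite_lessThan[of n]]] by auto
  note vS = diag[OF v] and uS = diag[OF u]
  note vT = F.K.S_carrierD[OF vS] and uT = F.K.S_carrierD(1)[OF uS]
  have "pure (\<lambda>_. v) \<otimes>\<^bsub>T\<^esub> X \<in> carrier S"
  proof (rule F.K.S_carrierI)
    show "pure (\<lambda>_. v) \<otimes>\<^bsub>T\<^esub> X \<in> carrier T" using vT X by simp
    show "permute_tensor \<sigma> (pure (\<lambda>_. v) \<otimes>\<^bsub>T\<^esub> X) = pure (\<lambda>_. v) \<otimes>\<^bsub>T\<^esub> X" if "\<sigma> permutes {..<n}" for \<sigma>
      by (simp only: alg_homD(2)[OF F.K.permute_tensor_alg_hom[OF that] vT(1) X] vT(2)[OF that] inv[OF that])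
  qed
  moreover have "F.hom (pure (\<lambda>_. v) \<otimes>\<^bsub>T\<^esub> pure (\<lambda>_. u)) \<otimes>\<^bsub>SQ\<^esub> Y = F.hom (pure (\<lambda>_. v) \<otimes>\<^bsub>T\<^esub> X)"
  proof -
    have "F.hom (pure (\<lambda>_. v) \<otimes>\<^bsub>T\<^esub> pure (\<lambda>_. u)) \<otimes>\<^bsub>TQ\<^esub> Y
        = F.hom (pure (\<lambda>_. v)) \<otimes>\<^bsub>TQ\<^esub> (F.hom (pure (\<lambda>_. u)) \<otimes>\<^bsub>TQ\<^esub> Y)"
      using vT uT YT by (simp add: F.L.T.m_assoc)
    also have "\<dots> = F.hom (pure (\<lambda>_. v) \<otimes>\<^bsub>T\<^esub> X)" unfolding uY using vT X by simp
    finally show ?thesis by (simp only: F.L.S_sel)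
  qed
  moreover have "pure (\<lambda>_. v) \<otimes>\<^bsub>T\<^esub> pure (\<lambda>_. u) \<in> D"
    using submonoid.m_closed[OF D_submonoid, of "pure (\<lambda>_. v)" "pure (\<lambda>_. u)"] u v
    unfolding F.K.S_sel diagonal_tensors_def by blast
  ultimately show ?thesis by blast
qed

theorem symmetric_tensors_localization:
  "\<exists>!\<phi>. \<phi> \<in> extensional (carrier (frac_algebra S D)) \<and> \<phi> \<in> alg_iso A (frac_algebra S D) SQ
    \<and> (\<forall>X\<in>carrier S. \<phi> (to_frac S D X) = F.hom X)"
proof -
  interpret locS: algebra_localization A S D
    by (rule algebra_localization.intro[OF F.K.S_algebra D_submonoid])
  show ?thesis
  proof (rule locS.localization_criterion[OF F.L.S_algebra hom_symmetric_alg_hom])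
    fix d assume "d \<in> D"
    then show "F.hom d \<in> Units SQ" unfolding diagonal_tensors_def using diagonal_unit by blast
  next
    fix X assume "X \<in> carrier S" "F.hom X = \<zero>\<^bsub>SQ\<^esub>"
    then show "\<exists>d\<in>D. d \<otimes>\<^bsub>S\<^esub> X = \<zero>\<^bsub>S\<^esub>"
      using hom_kernel[of X] F.K.S_carrierD(1) unfolding diagonal_tensors_def F.K.S_sel(2-5) F.L.S_sel(2-5)
      by blast
  qed (rule clear_denominators_symmetric)
qed

end

theorem proposition6p4:
  fixes A :: "('a, 'm) ring_scheme"
    and K :: "('a, 'b, 'k) module_scheme"
    and U :: "'b set"
    and n :: nat
  assumes "cring A"
    and "algebra A K"
    and "submonoid U K"
    and "n > 0"
  shows
    "(\<exists>!\<phi>. \<phi> \<in> extensional (carrier (frac_algebra (symmetric_tensors A n K) (diagonal_tensors A n K U)))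
        \<and> \<phi> \<in> alg_iso A (frac_algebra (symmetric_tensors A n K) (diagonal_tensors A n K U))
                       (symmetric_tensors A n (frac_algebra K U))
        \<and> (\<forall>X \<in> carrier (symmetric_tensors A n K).
             \<phi> (to_frac (symmetric_tensors A n K) (diagonal_tensors A n K U) X)
               = tensor_power_map A n K (frac_algebra K U) (to_frac K U) X))
     \<and> (\<forall>V. submonoid V (UP A) \<longrightarrow>
       (\<exists>!\<phi>. \<phi> \<in> extensional (carrier (frac_algebra (symmetric_tensors A n (UP A)) (diagonal_tensors A n (UP A) V)))
        \<and> \<phi> \<in> alg_iso A (frac_algebra (symmetric_tensors A n (UP A)) (diagonal_tensors A n (UP A) V))
                       (symmetric_tensors A n (frac_algebra (UP A) V))
        \<and> (\<forall>X \<in> carrier (symmetric_tensors A n (UP A)).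
             \<phi> (to_frac (symmetric_tensors A n (UP A)) (diagonal_tensors A n (UP A) V) X)
               = tensor_power_map A n (UP A) (frac_algebra (UP A) V) (to_frac (UP A) V) X)))"
proof (intro conjI allI impI)
  show "\<exists>!\<phi>. \<phi> \<in> extensional (carrier (frac_algebra (symmetric_tensors A n K) (diagonal_tensors A n K U)))
        \<and> \<phi> \<in> alg_iso A (frac_algebra (symmetric_tensors A n K) (diagonal_tensors A n K U))
                       (symmetric_tensors A n (frac_algebra K U))
        \<and> (\<forall>X \<in> carrier (symmetric_tensors A n K).
             \<phi> (to_frac (symmetric_tensors A n K) (diagonal_tensors A n K U) X)
               = tensor_power_map A n K (frac_algebra K U) (to_frac K U) X)"
    by (intro tensor_localization.symmetric_tensors_localization tensor_localization.intro
        algebra_localization.intro assms)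
next
  fix V assume "submonoid V (UP A)"
  have "algebra A (UP A)"
    using UP_cring.UP_algebra[OF UP_cring.intro[OF assms(1)]] .
  then show "\<exists>!\<phi>. \<phi> \<in> extensional (carrier (frac_algebra (symmetric_tensors A n (UP A)) (diagonal_tensors A n (UP A) V)))
        \<and> \<phi> \<in> alg_iso A (frac_algebra (symmetric_tensors A n (UP A)) (diagonal_tensors A n (UP A) V))
                       (symmetric_tensors A n (frac_algebra (UP A) V))
        \<and> (\<forall>X \<in> carrier (symmetric_tensors A n (UP A)).
             \<phi> (to_frac (symmetric_tensors A n (UP A)) (diagonal_tensors A n (UP A) V) X)
               = tensor_power_map A n (UP A) (frac_algebra (UP A) V) (to_frac (UP A) V) X)"
    using \<open>submonoid V (UP A)\<close>
    by (intro tensor_localization.symmetric_tensors_localization tensor_localization.intro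
        algebra_localization.intro)
qed

end
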